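(* Consider a $\{0,L\}$-instance of the capacitated $k$-center problem with vertex set $V$, metric $c$ and capacities $L(\cdot)$, and let $\tau\geq 0$. Let $G_{\leq\tau}$ be the graph on $V$ (with a loop at every vertex) in which $u,v$ are adjacent iff $c(u,v)\leq\tau$, and let $G'$ be obtained from $G_{\leq\tau}$ by removing every edge both of whose endpoints have capacity $0$. Let $G^*=(V^*,E^* )$ be a connected component of $G'$, and suppose $\mathrm{LP}_k(G^* )$ is feasible for some integer $k$. Then there is an algorithm that computes a set of $k$ vertices of $V^*$ to open and an assignment of every vertex $u\in V^*$ to an open center $v$ such that $d_{G^*}(u,v)\leq 6$ and every open center $v$ is assigned at most its capacity many vertices.
   Context: A $\{0,L\}$-instance is one where every vertex capacity is either $0$ or $L$ for some integer $L$. For a graph $H=(V^*,E^* )$ with capacities, $\mathrm{LP}_k(H)$ is the feasibility linear program in variables $x_{uv}$ and $y_u$ ($u,v\in V^*$): $\sum_u y_u=k$; $x_{uv}\leq y_u$; $\sum_{v:(u,v)\in E^*}x_{uv}\leq L(u)y_u$ for all $u$; $\sum_{u:(u,v)\in E^*}x_{uv}=1$ for all $v$; $0\leq x,y\leq1$. $d_{G^*}$ denotes shortest-path distance in $G^*$. *)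

theory Defs
  imports "HOL-Analysis.Abstract_Metric_Spaces" "HOL-Library.Nat_Bijection"
    "Graph_Theory.Digraph_Component" "Graph_Theory.Shortest_Path"
begin

section \<open>Algorithms: mu-recursive programs\<close>

datatype recf =
    Zero
  | Succ
  | Proj nat
  | Comp recf "recf list"
  | PrimRec recf recf
  | Mu recf

text \<open>\<open>computes p xs y\<close>: the program \<open>p\<close> halts on the argument list \<open>xs\<close> with result \<open>y\<close>.
  The recursion variable of \<open>PrimRec\<close> and the search variable of \<open>Mu\<close> come first.\<close>

inductive computes :: "recf \<Rightarrow> nat list \<Rightarrow> nat \<Rightarrow> bool" where
  Zero: "computes Zero xs 0"
| Succ: "computes Succ (x # xs) (Suc x)"
| Proj: "i < length xs \<Longrightarrow> computes (Proj i) xs (xs ! i)"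
| Comp: "\<lbrakk>length ys = length gs; \<forall>i<length gs. computes (gs ! i) xs (ys ! i);
          computes f ys z\<rbrakk> \<Longrightarrow> computes (Comp f gs) xs z"
| PrimRec_0: "computes f xs y \<Longrightarrow> computes (PrimRec f g) (0 # xs) y"
| PrimRec_Suc: "\<lbrakk>computes (PrimRec f g) (n # xs) r; computes g (n # r # xs) y\<rbrakk>
    \<Longrightarrow> computes (PrimRec f g) (Suc n # xs) y"
| Mu: "\<lbrakk>computes f (m # xs) 0; \<forall>i<m. \<exists>v. computes f (i # xs) (Suc v)\<rbrakk>
    \<Longrightarrow> computes (Mu f) xs m"

inductive_cases computes_ZeroE: "computes Zero xs y"
inductive_cases computes_SuccE: "computes Succ xs y"
inductive_cases computes_ProjE: "computes (Proj i) xs y"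
inductive_cases computes_CompE: "computes (Comp f gs) xs y"
inductive_cases computes_PrimRec_0E: "computes (PrimRec f g) (0 # xs) y"
inductive_cases computes_PrimRec_SucE: "computes (PrimRec f g) (Suc n # xs) y"
inductive_cases computes_MuE: "computes (Mu f) xs y"

lemma computes_deterministic:
  "computes p xs y \<Longrightarrow> computes p xs y' \<Longrightarrow> y = y'"
proof (induction arbitrary: y' rule: computes.induct)
  case (Zero xs)
  then show ?case by (rule computes_ZeroE) simp
next
  case (Succ x xs)
  then show ?case by (rule computes_SuccE) simp
next
  case (Proj i xs)
  from Proj.prems show ?case by (rule computes_ProjE) simp
next
  case (PrimRec_0 f xs y g)
  from PrimRec_0.prems have "computes f xs y'" by (rule computes_PrimRec_0E)
  then show ?case by (rule PrimRec_0.IH)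
next
  case (Comp ys gs xs f z)
  from Comp.prems obtain ys' where ys': "length ys' = length gs"
    "\<forall>i<length gs. computes (gs ! i) xs (ys' ! i)" "computes f ys' y'"
    by (rule computes_CompE)
  have "ys = ys'"
    using Comp.hyps(1) Comp.IH(1) ys'(1,2) by (intro nth_equalityI) auto
  then show ?case using Comp.IH(2) ys'(3) by blast
next
  case (PrimRec_Suc f g n xs r y)
  from PrimRec_Suc.prems obtain r' where "computes (PrimRec f g) (n # xs) r'"
    "computes g (n # r' # xs) y'"
    by (rule computes_PrimRec_SucE)
  with PrimRec_Suc.IH show ?case by blast
next
  case (Mu f m xs)
  from Mu.prems obtain z': "computes f (y' # xs) 0"
    and b': "\<forall>i<y'. \<exists>v. computes f (i # xs) (Suc v)"
    by (rule computes_MuE)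
  show ?case
  proof (rule linorder_cases[of m y'])
    assume "m < y'"
    then show ?thesis using b' Mu.IH(1) by (metis Zero_not_Suc)
  next
    assume "y' < m"
    then show ?thesis using z' Mu.IH(2) by (metis Zero_not_Suc)
  qed
qed


section \<open>Instances, threshold graphs, and the linear program\<close>

definition zero_L_instance :: "'a set \<Rightarrow> ('a \<Rightarrow> 'a \<Rightarrow> real) \<Rightarrow> ('a \<Rightarrow> nat) \<Rightarrow> bool" where
  "zero_L_instance V c cap \<longleftrightarrow>
     finite V \<and> Metric_space V c \<and> (\<exists>L. \<forall>u\<in>V. cap u = 0 \<or> cap u = L)"

text \<open>Undirected graphs are symmetric digraphs.  Since \<open>c u u = 0\<close>, every vertex carries a loop
  when \<open>\<tau> \<ge> 0\<close>.\<close>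

definition threshold_graph :: "'a set \<Rightarrow> ('a \<Rightarrow> 'a \<Rightarrow> real) \<Rightarrow> real \<Rightarrow> 'a pair_pre_digraph" where
  "threshold_graph V c \<tau> = \<lparr>pverts = V, parcs = {(u, v). u \<in> V \<and> v \<in> V \<and> c u v \<le> \<tau>}\<rparr>"

definition remove_zero_edges :: "('a \<Rightarrow> nat) \<Rightarrow> 'a pair_pre_digraph \<Rightarrow> 'a pair_pre_digraph" where
  "remove_zero_edges cap G =
     \<lparr>pverts = pverts G, parcs = parcs G - {(u, v). cap u = 0 \<and> cap v = 0}\<rparr>"

text \<open>\<open>connected\<close> and the record of graphs are those of the graph library.\<close>

definition is_component :: "('a, 'b) pre_digraph \<Rightarrow> ('a, 'b) pre_digraph \<Rightarrow> bool" where
  "is_component G H \<longleftrightarrow> pre_digraph.max_subgraph G Digraph_Component.connected H"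

definition graph_dist :: "('a, 'b) pre_digraph \<Rightarrow> 'a \<Rightarrow> 'a \<Rightarrow> ereal" where
  "graph_dist H u v = wf_digraph.\<mu> H (\<lambda>_. 1) u v"

definition LP_feasible :: "int \<Rightarrow> ('a \<Rightarrow> nat) \<Rightarrow> ('a, 'b) pre_digraph \<Rightarrow> bool" where
  "LP_feasible k cap H \<longleftrightarrow>
     (\<exists>(x :: 'a \<Rightarrow> 'a \<Rightarrow> real) (y :: 'a \<Rightarrow> real).
        (\<Sum>u\<in>verts H. y u) = of_int k \<and>
        (\<forall>u\<in>verts H. \<forall>v\<in>verts H. x u v \<le> y u) \<and>
        (\<forall>u\<in>verts H. (\<Sum>v | v \<in> verts H \<and> (u, v) \<in> arcs_ends H. x u v) \<le> real (cap u) * y u) \<and>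
        (\<forall>v\<in>verts H. (\<Sum>u | u \<in> verts H \<and> (u, v) \<in> arcs_ends H. x u v) = 1) \<and>
        (\<forall>u\<in>verts H. \<forall>v\<in>verts H. 0 \<le> x u v \<and> x u v \<le> 1) \<and>
        (\<forall>u\<in>verts H. 0 \<le> y u \<and> y u \<le> 1))"


section \<open>Solutions and encodings\<close>

definition is_solution ::
  "nat \<Rightarrow> int \<Rightarrow> ('a \<Rightarrow> nat) \<Rightarrow> ('a, 'b) pre_digraph \<Rightarrow> 'a set \<Rightarrow> ('a \<Rightarrow> 'a) \<Rightarrow> bool" where
  "is_solution r k cap H S \<phi> \<longleftrightarrow>
     S \<subseteq> verts H \<and> int (card S) = k \<and>
     (\<forall>u\<in>verts H. \<phi> u \<in> S \<and> graph_dist H u (\<phi> u) \<le> ereal (real r)) \<and>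
     (\<forall>v\<in>S. card {u \<in> verts H. \<phi> u = v} \<le> cap v)"

text \<open>Programs work on natural numbers, so the vertices are named by an injective labelling
  \<open>\<nu>\<close>, and finite sets, relations and functions on them are coded by \<open>set_encode\<close> and
  \<open>prod_encode\<close>.  If \<open>LP_feasible k cap H\<close> holds then \<open>k \<ge> 0\<close>, so \<open>nat k\<close> loses nothing.\<close>

definition encode_instance ::
  "('a \<Rightarrow> nat) \<Rightarrow> int \<Rightarrow> ('a \<Rightarrow> nat) \<Rightarrow> ('a, 'b) pre_digraph \<Rightarrow> nat list" where
  "encode_instance \<nu> k cap H =
     [nat k,
      set_encode (\<nu> ` verts H),
      set_encode ((\<lambda>(u, v). prod_encode (\<nu> u, \<nu> v)) ` arcs_ends H),
      set_encode ((\<lambda>u. prod_encode (\<nu> u, cap u)) ` verts H)]"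

definition encode_solution ::
  "('a \<Rightarrow> nat) \<Rightarrow> ('a, 'b) pre_digraph \<Rightarrow> 'a set \<Rightarrow> ('a \<Rightarrow> 'a) \<Rightarrow> nat" where
  "encode_solution \<nu> H S \<phi> =
     prod_encode (set_encode (\<nu> ` S),
                  set_encode ((\<lambda>u. prod_encode (\<nu> u, \<nu> (\<phi> u))) ` verts H))"

end

theory Submission
  imports Defs
begin

text \<open>
  Rounding.  Let \<open>F\<close> be the vertices of capacity \<open>L\<close>, and let \<open>nb v\<close> be the facilities within distance 1
  of \<open>v\<close>; the LP gives every \<open>nb v\<close> total opening at least 1.  Choose a maximal tree of centers with
  disjoint sets \<open>nb\<close> in which every new center is within distance 2 of a facility (its hub) in \<open>nb\<close> of
  an earlier center.  By maximality every vertex is next to such a facility.  Sweep the tree from the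
  leaves to the root.  At each center an integral amount of opening is rounded locally, and at
  most one unit, taken from \<open>nb\<close> of the center, is passed to its hub together with one unopened site.
  No opening moves further than 5.  Clients are within distance 1 of the facilities that serve them
  fractionally, so Hall's theorem yields an assignment over distance at most 6 to at most \<open>k\<close> open
  facilities, and arbitrary further vertices are opened to reach \<open>k\<close>.

  Algorithm.  Whether a number encodes a solution is expressible with bounded quantifiers, so
  unbounded search for the least such number is a mu-recursive program, and it halts because a
  solution exists.
\<close>

section \<open>Rounding fractional openings along a tree of centers\<close>

text \<open>The mass near a center is rarely integral, so a remainder has to travel; the danger is
  that remainders accumulate distance or find no room. Both are settled by what is exported. The
  exported mass lies in \<open>nb p\<close>, so it is within 1 + 2 = 3 of the hub, whatever arrived
  at \<open>p\<close> before, and its site is within 2 of the hub. Swapping sites among the items of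
  one hub costs 3 + 2 = 5, and moving an item into \<open>nb p'\<close> around the receiving center
  \<open>p'\<close> costs 3 + 1 + 1 = 5; the client adds 1. Room is provided by the site: the
  facilities in \<open>nb p'\<close> may all be fully open already, so each item, of at most one
  unit, brings along a facility that is still closed.

  Equal capacities are what turns openings into service: an opening moved from one facility to
  another still supports \<open>L\<close> clients per unit.

  The remainder handed on is always positive and at most 1, and only the root rounds it up. Hence
  fewer than \<open>sum y F + 1\<close> facilities are opened, which suffices although
  \<open>sum y F\<close> need not be an integer.\<close>

locale cap_graph =
  fixes V :: "'a set" and E :: "('a \<times> 'a) set" and F :: "'a set"
  assumes finite_V: "finite V"
    and F_subset: "F \<subseteq> V"
    and E_subset: "E \<subseteq> V \<times> V"
    and sym_E: "sym E"
    and edge_F: "(u, v) \<in> E \<Longrightarrow> u \<in> F \<or> v \<in> F"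
begin

section \<open>Balls in the graph and fractional transfers\<close>

definition nearby :: "nat \<Rightarrow> 'a \<Rightarrow> 'a \<Rightarrow> bool" where
  "nearby n u v \<longleftrightarrow> (u, v) \<in> (E \<union> Id) ^^ n"

lemma nearby_refl: "nearby n u u"
  by (induction n) (auto simp: nearby_def)

lemma nearby_trans: "nearby a u v \<Longrightarrow> nearby b v w \<Longrightarrow> nearby (a + b) u w"
  unfolding nearby_def relpow_add by auto

lemma nearby_mono: "nearby a u v \<Longrightarrow> a \<le> b \<Longrightarrow> nearby b u v"
  using nearby_trans[of a u v "b - a" v] nearby_refl by simp

lemma nearby_le: "nearby a u v \<Longrightarrow> nearby b v w \<Longrightarrow> a + b \<le> c \<Longrightarrow> nearby c u w"
  using nearby_trans nearby_mono by blast

lemma nearby_sym: "nearby n u v \<longleftrightarrow> nearby n v u"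
proof -
  have "nearby n u v \<Longrightarrow> nearby n v u" for u v
  proof (induction n arbitrary: v)
    case (Suc n)
    then obtain w where w: "nearby n u w" "(w, v) \<in> E \<union> Id"
      by (auto simp: nearby_def)
    have "(v, w) \<in> E \<union> Id"
      using w(2) sym_E by (auto dest: symD)
    then have "nearby 1 v w"
      by (simp add: nearby_def)
    then show ?case
      using nearby_trans[of 1 v w n u] Suc.IH[OF w(1)] by simp
  qed (simp add: nearby_def)
  then show ?thesis by blast
qed

lemma nearby_1: "nearby 1 u v \<longleftrightarrow> u = v \<or> (u, v) \<in> E"
  by (auto simp: nearby_def)

lemma nearby_Suc: "nearby (Suc n) u w \<longleftrightarrow> (\<exists>v. nearby n u v \<and> nearby 1 v w)"
  by (auto simp: nearby_def)

text \<open>By Hall's theorem this says that the masses \<open>Y\<close> can be moved fractionally to sinks with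
  capacities \<open>B\<close>, each over distance at most 5.  Unlike the moves themselves, the condition is
  visibly additive.\<close>

definition transfer :: "('a \<Rightarrow> real) \<Rightarrow> ('a \<Rightarrow> real) \<Rightarrow> bool" where
  "transfer Y B \<longleftrightarrow> (\<forall>U\<subseteq>V. sum Y U \<le> sum B {s \<in> V. \<exists>u\<in>U. nearby 5 u s})"

lemma transfer_add:
  assumes "transfer Y B" "transfer Y' B'"
  shows "transfer (\<lambda>u. Y u + Y' u) (\<lambda>s. B s + B' s)"
  using assms unfolding transfer_def sum.distrib by (meson add_mono)

lemma transfer_cong:
  assumes "\<And>u. u \<in> V \<Longrightarrow> Y u = Y' u" "\<And>s. s \<in> V \<Longrightarrow> B s = B' s"
  shows "transfer Y B \<longleftrightarrow> transfer Y' B'"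
proof -
  have "sum Y U = sum Y' U" if "U \<subseteq> V" for U
    using assms(1) that by (intro sum.cong) auto
  moreover have "sum B {s \<in> V. \<exists>u\<in>U. nearby 5 u s} = sum B' {s \<in> V. \<exists>u\<in>U. nearby 5 u s}" for U
    using assms(2) by (intro sum.cong) auto
  ultimately show ?thesis
    unfolding transfer_def by simp
qed

lemma transfer_sum:
  assumes "finite A" "\<And>a. a \<in> A \<Longrightarrow> transfer (Y a) (B a)"
  shows "transfer (\<lambda>u. \<Sum>a\<in>A. Y a u) (\<lambda>s. \<Sum>a\<in>A. B a s)"
  using assms by (induction A) (auto simp: transfer_def[of "\<lambda>_. 0"] intro!: transfer_add)

lemma transfer_complete:
  assumes "\<And>u. u \<in> V \<Longrightarrow> 0 \<le> Y u" "\<And>s. s \<in> V \<Longrightarrow> 0 \<le> B s"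
    and "sum Y V \<le> sum B V"
    and close: "\<And>u s. u \<in> V \<Longrightarrow> s \<in> V \<Longrightarrow> Y u > 0 \<Longrightarrow> B s > 0 \<Longrightarrow> nearby 5 u s"
  shows "transfer Y B"
  unfolding transfer_def
proof (intro allI impI)
  fix U assume U: "U \<subseteq> V"
  let ?N = "{s \<in> V. \<exists>u\<in>U. nearby 5 u s}"
  show "sum Y U \<le> sum B ?N"
  proof (cases "\<exists>u\<in>U. Y u > 0")
    case True
    then obtain u where u: "u \<in> U" "Y u > 0" by blast
    have "B s = 0" if "s \<in> V - ?N" for s
      using that close[of u s] u U assms(2)[of s] by force
    then have "sum B ?N = sum B V"
      by (intro sum.mono_neutral_left) (auto simp: finite_V)
    moreover have "sum Y U \<le> sum Y V"
      using U assms(1) finite_V by (intro sum_mono2) auto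
    ultimately show ?thesis using assms(3) by linarith
  next
    case False
    then have "sum Y U \<le> 0"
      by (intro sum_nonpos) force
    also have "0 \<le> sum B ?N"
      using assms(2) by (intro sum_nonneg) auto
    finally show ?thesis .
  qed
qed

lemma sum_of_bool_card:
  assumes "S \<subseteq> V"
  shows "(\<Sum>s\<in>V. of_bool (s \<in> S)) = real (card S)"
proof -
  have "(\<Sum>s\<in>V. of_bool (s \<in> S)) = (\<Sum>s\<in>S. of_bool (s \<in> S) :: real)"
    using assms finite_V by (intro sum.mono_neutral_right) auto
  then show ?thesis by simp
qed

section \<open>Rounding at a single center\<close>

lemma round_up_pred:
  fixes G :: real
  assumes "G > 0"
  obtains n r where "0 < r" "r \<le> 1" "real n = G - r"
proof
  \<comment> \<open>Rounding up and subtracting one, instead of rounding down, keeps the remainder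
    positive even when \<open>G\<close> is an integer.\<close>
  show "0 < G - real (nat (\<lceil>G\<rceil> - 1))" "G - real (nat (\<lceil>G\<rceil> - 1)) \<le> 1"
    using assms by linarith+
qed simp

text \<open>Mass that is waiting to be assigned comes in items: \<open>m s\<close> is the distribution of an item of total
  mass at most 1, \<open>s\<close> is a site reserved for it and not opened yet, and \<open>h\<close> is its hub, within
  distance 3 of the mass and 2 of the site.  Items with a common hub can therefore use each other's
  sites, and all but one of them (with mass \<open>r\<close> left) are disposed of at the hub.\<close>

lemma hub_group:
  assumes I: "finite I" "I \<noteq> {}" "I \<subseteq> V"
    and site: "\<And>s. s \<in> I \<Longrightarrow> nearby 2 s h"
    and m_nonneg: "\<And>s u. s \<in> I \<Longrightarrow> u \<in> V \<Longrightarrow> 0 \<le> m s u"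
    and m_near: "\<And>s u. s \<in> I \<Longrightarrow> u \<in> V \<Longrightarrow> m s u > 0 \<Longrightarrow> nearby 3 u h"
    and mass: "\<And>s. s \<in> I \<Longrightarrow> 0 < sum (m s) V" "\<And>s. s \<in> I \<Longrightarrow> sum (m s) V \<le> 1"
    and G: "G = (\<Sum>s\<in>I. sum (m s) V)"
  shows "\<exists>S t r. S \<subseteq> I \<and> t \<in> I - S \<and> 0 < r \<and> r \<le> 1 \<and> r \<le> G \<and> real (card S) = G - r \<and>
    transfer (\<lambda>u. (1 - r / G) * (\<Sum>s\<in>I. m s u)) (\<lambda>s. of_bool (s \<in> S))"
proof -
  have "G > 0"
    unfolding G using I(1,2) mass(1) by (rule sum_pos)
  then obtain n r where r: "0 < r" "r \<le> 1" "real n = G - r"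
    by (rule round_up_pred)
  have "G \<le> real (card I)"
    using sum_bounded_above[of I "\<lambda>s. sum (m s) V" 1] mass(2) by (simp add: G)
  \<comment> \<open>Items weigh at most 1 and the remainder is positive, so opening \<open>n\<close>
    sites leaves at least one reserved site closed for it.\<close>
  then have "n < card I" using r by linarith
  then obtain S where S: "S \<subseteq> I" "card S = n"
    using obtain_subset_with_card_n[of n I] by auto
  have "I - S \<noteq> {}" using S \<open>n < card I\<close> by auto
  then obtain t where t: "t \<in> I - S" by blast
  have "r \<le> G" using r by linarith
  have frac: "0 \<le> 1 - r / G"
    using \<open>r \<le> G\<close> \<open>G > 0\<close> by simp
  \<comment> \<open>The same fraction of every item is settled here; the remaining fractions, of
    total mass \<open>r\<close>, will act as one item with site \<open>t\<close>.\<close>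
  have tr: "transfer (\<lambda>u. (1 - r / G) * (\<Sum>s\<in>I. m s u)) (\<lambda>s. of_bool (s \<in> S))"
  proof (rule transfer_complete)
    fix u assume "u \<in> V"
    then show "0 \<le> (1 - r / G) * (\<Sum>s\<in>I. m s u)"
      using m_nonneg frac by (intro mult_nonneg_nonneg sum_nonneg) auto
  next
    have "(\<Sum>u\<in>V. (1 - r / G) * (\<Sum>s\<in>I. m s u)) = (1 - r / G) * G"
      unfolding G sum_distrib_left[symmetric] by (subst sum.swap) simp
    also have "\<dots> = real (card S)"
      using r S \<open>G > 0\<close> by (simp add: left_diff_distrib)
    finally show "(\<Sum>u\<in>V. (1 - r / G) * (\<Sum>s\<in>I. m s u)) \<le> (\<Sum>s\<in>V. of_bool (s \<in> S))"
      using sum_of_bool_card[of S] S I by simp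
  next
    fix u s assume *: "u \<in> V" "s \<in> V" "(1 - r / G) * (\<Sum>s\<in>I. m s u) > 0" "of_bool (s \<in> S) > (0::real)"
    then have "\<not> (\<forall>s'\<in>I. m s' u \<le> 0)"
      using frac sum_nonpos[of I "\<lambda>s. m s u"] by (auto simp: zero_less_mult_iff)
    then obtain s' where "s' \<in> I" "m s' u > 0" by force
    then have "nearby 3 u h" using m_near *(1) by blast
    moreover have "nearby 2 h s"
      using site[of s] * S by (auto simp: nearby_sym)
    ultimately show "nearby 5 u s" by (rule nearby_le) simp
  qed auto
  show ?thesis
    using S t r \<open>r \<le> G\<close> tr by blast
qed

text \<open>Here \<open>P\<close> is the set of facilities next to a center \<open>p\<close>, \<open>q\<close> is the site that \<open>p\<close> reserves for its
  own item, \<open>N\<close> is the mass in \<open>P\<close> that is not exported, and \<open>H\<close> is the set of hubs that have an item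
  left.  If \<open>P - {q}\<close> is too small, all of it is opened together with the sites of the items in some
  \<open>J\<close>.  The items outside \<open>J\<close> are at most \<open>card (P - {q})\<close> many and hence fit into \<open>P - {q}\<close>, an item
  in \<open>J\<close> stays at its own site, and \<open>N\<close>, which is close to everything, fills the gaps.\<close>

lemma local_rounding:
  assumes P: "P \<subseteq> V" "q \<in> P" "\<And>u. u \<in> P \<Longrightarrow> nearby 1 u p"
    and N: "\<And>u. u \<in> V \<Longrightarrow> 0 \<le> N u" "\<And>u. u \<in> V \<Longrightarrow> N u > 0 \<Longrightarrow> u \<in> P" "sum N V < real (card P)"
    and H: "finite H" "card H \<le> card P" "inj_on t H" "t ` H \<subseteq> V" "t ` H \<inter> P = {}"
    and g_nonneg: "\<And>h u. h \<in> H \<Longrightarrow> u \<in> V \<Longrightarrow> 0 \<le> g h u"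
    and g_near: "\<And>h u. h \<in> H \<Longrightarrow> u \<in> V \<Longrightarrow> g h u > 0 \<Longrightarrow> nearby 4 u p \<and> nearby 5 u (t h)"
    and t_near: "\<And>h. h \<in> H \<Longrightarrow> nearby 3 p (t h)"
    and r: "\<And>h. h \<in> H \<Longrightarrow> sum (g h) V = r h" "\<And>h. h \<in> H \<Longrightarrow> 0 < r h" "\<And>h. h \<in> H \<Longrightarrow> r h \<le> 1"
    and K: "sum N V + sum r H = real K"
  shows "\<exists>S. S \<subseteq> (P - {q}) \<union> t ` H \<and> card S = K \<and>
    transfer (\<lambda>u. N u + (\<Sum>h\<in>H. g h u)) (\<lambda>s. of_bool (s \<in> S))"
proof -
  let ?A = "P - {q}"
  have finP: "finite P" using P finite_V finite_subset by blast
  have cardA: "card P = card ?A + 1"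
    using finP P by (metis Suc_eq_plus1 card_Suc_Diff1)
  have sum_g: "(\<Sum>u\<in>V. \<Sum>h\<in>H'. g h u) = sum r H'" if "H' \<subseteq> H" for H'
    using r(1) that by (subst sum.swap) (auto intro!: sum.cong)
  have pos_ex: "\<exists>h\<in>H'. f h > 0" if "(\<Sum>h\<in>H'. f h) > 0" for H' and f :: "'c \<Rightarrow> real"
    using that sum_nonpos[of H' f] by force
  have P_near: "nearby 5 u s" if "nearby 4 u p" "s \<in> P" for u s
  proof -
    have "nearby 1 p s" using P(3)[OF that(2)] nearby_sym by blast
    with that(1) show ?thesis by (rule nearby_le) simp
  qed
  have N_near: "nearby 4 u p" if "u \<in> V" "N u > 0" for u
    using P(3)[OF N(2)[OF that]] by (rule nearby_mono) simp
  show ?thesis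
  proof (cases "K \<le> card ?A")
    case True
    then obtain S where S: "S \<subseteq> ?A" "card S = K"
      using obtain_subset_with_card_n by metis
    have "transfer (\<lambda>u. N u + (\<Sum>h\<in>H. g h u)) (\<lambda>s. of_bool (s \<in> S))"
    proof (rule transfer_complete)
      fix u assume "u \<in> V"
      then show "0 \<le> N u + (\<Sum>h\<in>H. g h u)"
        using N(1) g_nonneg by (intro add_nonneg_nonneg sum_nonneg) auto
    next
      show "(\<Sum>u\<in>V. N u + (\<Sum>h\<in>H. g h u)) \<le> (\<Sum>s\<in>V. of_bool (s \<in> S))"
        using sum_of_bool_card[of S] S P(1) K sum_g[of H] by (auto simp: sum.distrib subset_iff)
    next
      fix u s assume *: "u \<in> V" "s \<in> V" "N u + (\<Sum>h\<in>H. g h u) > 0" "of_bool (s \<in> S) > (0::real)"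
      then have "N u > 0 \<or> (\<Sum>h\<in>H. g h u) > 0" by linarith
      then have "nearby 4 u p"
        using N_near[OF *(1)] g_near[OF _ *(1)] pos_ex[of "\<lambda>h. g h u" H] by blast
      then show "nearby 5 u s"
        using P_near * S by auto
    qed auto
    then show ?thesis using S by blast
  next
    case False
    \<comment> \<open>The strict bound on \<open>sum N V\<close> pays, by integrality, for the
      facility \<open>q\<close>, which is kept closed.\<close>
    have "K \<le> card ?A + card H"
    proof -
      have "sum r H \<le> real (card H)"
        using sum_bounded_above[of H r 1] r(3) by simp
      then have "real K < card ?A + 1 + card H"
        using N(3) K cardA by simp
      then show ?thesis by linarith
    qed
    then obtain J where J: "J \<subseteq> H" "card J = K - card ?A"
      using obtain_subset_with_card_n[of "K - card ?A" H] by (metis le_diff_conv add.commute)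
    have finJ: "finite J" using J H finite_subset by blast
    define R' where "R' = sum r (H - J)"
    \<comment> \<open>If \<open>?A\<close> is empty, the division gives \<open>c = 0\<close>, which
      is correct since then \<open>R' = 0\<close>.\<close>
    define c where "c = R' / card ?A"
    \<comment> \<open>\<open>K\<close> exceeds \<open>card ?A\<close>, so \<open>J\<close> is
      nonempty, and \<open>H\<close> has at most one element more than \<open>?A\<close>. Each item
      outside \<open>J\<close> weighs at most 1.\<close>
    have "R' \<le> card ?A"
    proof -
      have "R' \<le> real (card (H - J))"
        using sum_bounded_above[of "H - J" r 1] r(3) by (simp add: R'_def)
      moreover have "card (H - J) = card H - card J"
        using J finJ by (simp add: card_Diff_subset)
      then have "card (H - J) \<le> card ?A"
        using False J(2) H(2) cardA by linarith
      ultimately show ?thesis by linarith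
    qed
    moreover have "0 \<le> R'"
      unfolding R'_def using r(2) by (intro sum_nonneg) (auto simp: less_imp_le)
    ultimately have c: "0 \<le> c" "c \<le> 1" "c * card ?A = R'"
      unfolding c_def by (auto simp: divide_le_eq)
    have sumA: "(\<Sum>s\<in>V. x * of_bool (s \<in> ?A)) = x * card ?A" for x :: real
      using sum_of_bool_card[of ?A] P by (simp add: sum_distrib_left[symmetric] subset_eq)
    have sum1: "(\<Sum>s\<in>V. x * of_bool (s = t j)) = x" if "j \<in> J" for x :: real and j
      using finite_V that J H(4) sum.delta[of V "t j" "\<lambda>_. x"] by (auto simp: of_bool_def image_subset_iff if_distrib cong: if_cong)
    \<comment> \<open>The unit capacity of each opened site is divided: \<open>?B1\<close> receives
      the items outside \<open>J\<close>, \<open>?B2\<close> the items in \<open>J\<close>, and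
      \<open>?B3\<close> is the rest. The three add up to the indicator of
      \<open>?S\<close>.\<close>
    let ?B1 = "\<lambda>s. c * of_bool (s \<in> ?A)"
    let ?B2 = "\<lambda>s. \<Sum>j\<in>J. r j * of_bool (s = t j)"
    let ?B3 = "\<lambda>s. (1 - c) * of_bool (s \<in> ?A) + (\<Sum>j\<in>J. (1 - r j) * of_bool (s = t j))"
    let ?S = "?A \<union> t ` J"
    have t1: "transfer (\<lambda>u. \<Sum>h\<in>H - J. g h u) ?B1"
    proof (rule transfer_complete)
      show "(\<Sum>u\<in>V. \<Sum>h\<in>H - J. g h u) \<le> sum ?B1 V"
        unfolding sumA using c sum_g[of "H - J"] by (simp add: R'_def)
    next
      fix u s assume *: "u \<in> V" "s \<in> V" "(\<Sum>h\<in>H - J. g h u) > 0" "?B1 s > 0"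
      then have "s \<in> P" by (auto simp: of_bool_def split: if_splits)
      then show "nearby 5 u s"
        using P_near g_near[OF _ *(1)] pos_ex[OF *(3)] by blast
    qed (use g_nonneg c in \<open>auto intro: sum_nonneg\<close>)
    have t2: "transfer (\<lambda>u. \<Sum>j\<in>J. g j u) ?B2"
    proof (rule transfer_sum[OF finJ])
      fix j assume j: "j \<in> J"
      then have "j \<in> H" using J by blast
      show "transfer (g j) (\<lambda>s. r j * of_bool (s = t j))"
      proof (rule transfer_complete)
        show "sum (g j) V \<le> (\<Sum>s\<in>V. r j * of_bool (s = t j))"
          using sum1[OF j] r(1)[OF \<open>j \<in> H\<close>] by simp
        show "\<And>u s. u \<in> V \<Longrightarrow> s \<in> V \<Longrightarrow> 0 < g j u \<Longrightarrow> 0 < r j * of_bool (s = t j) \<Longrightarrow> nearby 5 u s"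
          using g_near[OF \<open>j \<in> H\<close>] by (auto simp: of_bool_def split: if_splits)
        show "\<And>s. 0 \<le> r j * of_bool (s = t j)"
          using r(2)[OF \<open>j \<in> H\<close>] by auto
      qed (use g_nonneg \<open>j \<in> H\<close> in auto)
    qed
    have t3: "transfer N ?B3"
    proof (rule transfer_complete)
      have "sum ?B3 V = (1 - c) * card ?A + (\<Sum>j\<in>J. \<Sum>s\<in>V. (1 - r j) * of_bool (s = t j))"
        by (simp only: sum.distrib sumA sum.swap[of _ J V])
      also have "(\<Sum>j\<in>J. \<Sum>s\<in>V. (1 - r j) * of_bool (s = t j)) = (\<Sum>j\<in>J. 1 - r j)"
        using sum1 by (intro sum.cong) auto
      also have "\<dots> = card J - sum r J" by (simp add: sum_subtractf)
      also have "sum r J = sum r H - R'"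
        unfolding R'_def using H J by (simp add: sum_diff)
      finally have "sum ?B3 V = card ?A - R' + card J - sum r H + R'"
        using c(3) by (simp add: left_diff_distrib)
      also have "\<dots> = sum N V"
        using K J(2) False by simp
      finally show "sum N V \<le> sum ?B3 V" by simp
    next
      fix u s assume *: "u \<in> V" "s \<in> V" "N u > 0" "?B3 s > 0"
      show "nearby 5 u s"
      proof (cases "s \<in> P")
        case True
        then show ?thesis using P_near N_near * by blast
      next
        case False
        with * have "(\<Sum>j\<in>J. (1 - r j) * of_bool (s = t j)) > 0" by simp
        from pos_ex[OF this] obtain j where "j \<in> J" "s = t j" by (auto simp: of_bool_def split: if_splits)
        then have "nearby 3 p s" using t_near J by blast
        moreover have "nearby 1 u p" using * N P by blast
        ultimately show ?thesis using nearby_le[of 1 u p 3 s 5] by simp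
      qed
    next
      fix s
      show "0 \<le> ?B3 s"
        using c r(3) J by (intro add_nonneg_nonneg sum_nonneg) auto
    qed (use N in auto)
    have "transfer (\<lambda>u. N u + (\<Sum>h\<in>H. g h u)) (\<lambda>s. of_bool (s \<in> ?S))"
    proof (rule transfer_cong[THEN iffD1, OF _ _ transfer_add[OF t3 transfer_add[OF t1 t2]]])
      fix u
      show "N u + ((\<Sum>h\<in>H - J. g h u) + (\<Sum>j\<in>J. g j u)) = N u + (\<Sum>h\<in>H. g h u)"
        using H J by (simp add: sum.subset_diff)
    next
      fix s
      have "?B2 s + (\<Sum>j\<in>J. (1 - r j) * of_bool (s = t j)) = (\<Sum>j\<in>J. of_bool (s = t j))"
        by (simp add: sum.distrib[symmetric] algebra_simps)
      also have "\<dots> = of_bool (s \<in> t ` J)"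
      proof (cases "s \<in> t ` J")
        case True
        then obtain j where j: "j \<in> J" "s = t j" by blast
        have "(\<Sum>i\<in>J. of_bool (s = t i) :: real) = (\<Sum>i\<in>J. if i = j then 1 else 0)"
        proof (rule sum.cong[OF refl])
          fix i assume "i \<in> J"
          then have "t j = t i \<longleftrightarrow> i = j"
            using H(3) J(1) \<open>i \<in> J\<close> j(1) unfolding inj_on_def by blast
          then show "(of_bool (s = t i) :: real) = (if i = j then 1 else 0)"
            using j by simp
        qed
        also have "\<dots> = 1" using j finJ by simp
        finally show ?thesis using True by simp
      qed (auto intro!: sum.neutral)
      finally show "?B3 s + (?B1 s + ?B2 s) = of_bool (s \<in> ?S)"
        using H(5) J by (auto simp: algebra_simps)
    qed
    moreover have "card ?S = K"
    proof -
      have "card (t ` J) = card J"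
        using H(3) J inj_on_subset card_image by blast
      moreover have "?A \<inter> t ` J = {}" using H(5) J by auto
      ultimately show ?thesis
        using card_Un_disjoint[of ?A "t ` J"] finP finJ J(2) False by simp
    qed
    moreover have "?S \<subseteq> ?A \<union> t ` H" using J by blast
    ultimately show ?thesis by blast
  qed
qed


text \<open>The center exports a proportional part of the mass in \<open>P\<close>, of total \<open>e\<close>.  Exporting this mass,
  which is next to \<open>p\<close>, rather than what is left over from the incoming items, keeps distances
  bounded along the tree.\<close>

lemma center_rounding:
  assumes P: "P \<subseteq> V" "q \<in> P" "\<And>u. u \<in> P \<Longrightarrow> nearby 1 u p"
    and y: "\<And>u. u \<in> P \<Longrightarrow> 0 \<le> y u" "\<And>u. u \<in> P \<Longrightarrow> y u \<le> 1" "1 \<le> sum y P"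
    and I: "finite I" "I \<subseteq> V" "I \<inter> P = {}"
    and hub: "\<And>s. s \<in> I \<Longrightarrow> hub s \<in> P" "\<And>s. s \<in> I \<Longrightarrow> nearby 2 s (hub s)"
    and m: "\<And>s u. s \<in> I \<Longrightarrow> u \<in> V \<Longrightarrow> 0 \<le> m s u"
      "\<And>s u. s \<in> I \<Longrightarrow> u \<in> V \<Longrightarrow> m s u > 0 \<Longrightarrow> nearby 3 u (hub s)"
    and mass: "\<And>s. s \<in> I \<Longrightarrow> 0 < sum (m s) V" "\<And>s. s \<in> I \<Longrightarrow> sum (m s) V \<le> 1"
  shows "\<exists>S e. S \<subseteq> I \<union> (P - {q}) \<and> 0 < e \<and> e \<le> 1 \<and>
    real (card S) = sum y P + (\<Sum>s\<in>I. sum (m s) V) - e \<and>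
    transfer (\<lambda>u. (1 - e / sum y P) * (if u \<in> P then y u else 0) + (\<Sum>s\<in>I. m s u))
      (\<lambda>s. of_bool (s \<in> S))"
proof -
  define H where "H = hub ` I"
  define J where "J h = {s \<in> I. hub s = h}" for h
  define G where "G h = (\<Sum>s\<in>J h. sum (m s) V)" for h
  define M where "M = sum y P"
  have finP: "finite P" using P finite_V finite_subset by blast
  have finH: "finite H" and "H \<subseteq> P" using I hub by (auto simp: H_def)
  have finJ: "finite (J h)" for h using I by (simp add: J_def)
  define Q where "Q h S t r \<longleftrightarrow> S \<subseteq> J h \<and> t \<in> J h - S \<and> 0 < r \<and> r \<le> 1 \<and> r \<le> G h \<and>
    real (card S) = G h - r \<and>
    transfer (\<lambda>u. (1 - r / G h) * (\<Sum>s\<in>J h. m s u)) (\<lambda>s. of_bool (s \<in> S))" for h S t r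
  have "\<exists>S t r. Q h S t r" if "h \<in> H" for h
  proof -
    have "J h \<noteq> {}" using that by (auto simp: H_def J_def)
    then show ?thesis
      unfolding Q_def using I hub mass m by (intro hub_group[where h = h]) (auto simp: J_def G_def)
  qed
  then obtain S t r where Q: "\<And>h. h \<in> H \<Longrightarrow> Q h (S h) (t h) (r h)"
    by metis
  then have grp: "\<And>h. h \<in> H \<Longrightarrow> S h \<subseteq> J h" "\<And>h. h \<in> H \<Longrightarrow> t h \<in> J h - S h"
    and r: "\<And>h. h \<in> H \<Longrightarrow> 0 < r h" "\<And>h. h \<in> H \<Longrightarrow> r h \<le> 1" "\<And>h. h \<in> H \<Longrightarrow> r h \<le> G h"
    and cardS: "\<And>h. h \<in> H \<Longrightarrow> real (card (S h)) = G h - r h"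
    and trS: "\<And>h. h \<in> H \<Longrightarrow> transfer (\<lambda>u. (1 - r h / G h) * (\<Sum>s\<in>J h. m s u)) (\<lambda>s. of_bool (s \<in> S h))"
    unfolding Q_def by blast+
  have hub_t: "hub (t h) = h" "t h \<in> I" if "h \<in> H" for h
    using grp(2)[OF that] by (auto simp: J_def)
  have regroup: "(\<Sum>h\<in>H. \<Sum>s\<in>J h. f s) = (\<Sum>s\<in>I. f s)" for f :: "'a \<Rightarrow> real"
    unfolding H_def J_def using sum.image_gen[OF I(1), of f hub] by simp
  define T where "T = M + sum G H"
  have "sum G H \<ge> 0"
    using r by (intro sum_nonneg) (meson less_imp_le order_trans)
  then have "T > 0" using y(3) by (simp add: T_def M_def)
  \<comment> \<open>Exporting \<open>e\<close> makes the total integral. As \<open>M\<close> is at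
    least 1, all of it can be taken from the mass in \<open>P\<close>.\<close>
  then obtain n e where e: "0 < e" "e \<le> 1" "real n = T - e"
    by (rule round_up_pred)
  define K where "K = n - (\<Sum>h\<in>H. card (S h))"
  define N where "N u = (1 - e / M) * (if u \<in> P then y u else 0)" for u
  define g where "g h u = r h / G h * (\<Sum>s\<in>J h. m s u)" for h u
  have frac: "0 \<le> 1 - e / M" using e y(3) by (simp add: M_def)
  have sumN: "sum N V = M - e"
  proof -
    have "sum N V = (1 - e / M) * (\<Sum>u\<in>V. if u \<in> P then y u else 0)"
      unfolding N_def by (simp add: sum_distrib_left)
    also have "(\<Sum>u\<in>V. if u \<in> P then y u else 0) = M"
      unfolding M_def using P finite_V by (simp add: sum.inter_restrict[symmetric] Int_absorb1)
    finally show ?thesis using y(3) by (simp add: M_def left_diff_distrib)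
  qed
  have sumg: "sum (g h) V = r h" if "h \<in> H" for h
  proof -
    have "sum (g h) V = r h / G h * (\<Sum>u\<in>V. \<Sum>s\<in>J h. m s u)"
      unfolding g_def by (simp add: sum_distrib_left)
    also have "(\<Sum>u\<in>V. \<Sum>s\<in>J h. m s u) = G h"
      unfolding G_def by (rule sum.swap)
    finally show ?thesis using r[OF that] by simp
  qed
  have sumcard: "real (\<Sum>h\<in>H. card (S h)) = sum G H - sum r H"
    using cardS by (simp add: sum_subtractf)
  have "sum r H \<ge> 0" using r(1) by (intro sum_nonneg) (auto simp: less_imp_le)
  then have "real (\<Sum>h\<in>H. card (S h)) \<le> real n"
    using sumcard e y(3) by (simp add: T_def M_def)
  then have "(\<Sum>h\<in>H. card (S h)) \<le> n" unfolding of_nat_le_iff .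
  then have K: "sum N V + sum r H = real K"
    unfolding K_def sumN using sumcard e by (simp only: T_def of_nat_diff)
  have g_pos: "nearby 3 u h" if "h \<in> H" "u \<in> V" "g h u > 0" for h u
  proof -
    have "(\<Sum>s\<in>J h. m s u) > 0"
      using that(3) r(1,3)[OF that(1)] unfolding g_def by (auto simp: zero_less_mult_iff zero_less_divide_iff)
    then have "\<exists>s\<in>J h. m s u > 0" using sum_nonpos[of "J h" "\<lambda>s. m s u"] by force
    then show ?thesis using m(2) that(2) by (auto simp: J_def)
  qed
  have t_site: "nearby 2 h (t h)" if "h \<in> H" for h
    using hub(2)[OF hub_t(2)[OF that]] hub_t(1)[OF that] nearby_sym by simp
  have near_h: "nearby 1 h p" if "h \<in> H" for h using that P(3) \<open>H \<subseteq> P\<close> by blast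
  have "\<exists>S0. S0 \<subseteq> (P - {q}) \<union> t ` H \<and> card S0 = K \<and>
    transfer (\<lambda>u. N u + (\<Sum>h\<in>H. g h u)) (\<lambda>s. of_bool (s \<in> S0))"
  proof (rule local_rounding[where p = p and r = r])
    show "P \<subseteq> V" "q \<in> P" "\<And>u. u \<in> P \<Longrightarrow> nearby 1 u p" by fact+
    show "0 \<le> N u" for u using y(1) frac by (auto simp: N_def)
    show "u \<in> P" if "N u > 0" for u using that by (auto simp: N_def split: if_splits)
    have "M \<le> card P" unfolding M_def using sum_bounded_above[of P y 1] y(2) by simp
    then show "sum N V < card P" using sumN e by simp
    \<comment> \<open>This is the gain from merging items at their hubs: one item is left per hub,
      and the hubs lie in \<open>P\<close>.\<close>
    show "card H \<le> card P" using \<open>H \<subseteq> P\<close> finP card_mono by blast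
    show "inj_on t H" using hub_t(1) by (rule inj_on_inverseI)
    show "t ` H \<subseteq> V" "t ` H \<inter> P = {}" using hub_t(2) I by blast+
    show "0 \<le> g h u" if "h \<in> H" "u \<in> V" for h u
      unfolding g_def using r[OF that(1)] m(1) that(2) by (intro mult_nonneg_nonneg divide_nonneg_nonneg sum_nonneg) (auto simp: J_def)
    \<comment> \<open>Through the hub \<open>h\<close>: 3 + 1 to the center and 3 + 2 to the site
      \<open>t h\<close>.\<close>
    show "nearby 4 u p \<and> nearby 5 u (t h)" if "h \<in> H" "u \<in> V" "g h u > 0" for h u
      using nearby_le[OF g_pos[OF that] near_h[OF that(1)], of 4]
        nearby_le[OF g_pos[OF that] t_site[OF that(1)], of 5] by simp
    show "nearby 3 p (t h)" if "h \<in> H" for h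
      using nearby_le[OF _ t_site[OF that], of 1 p 3] near_h[OF that] nearby_sym[of 1 p h] by simp
  qed (use finH sumg r K in auto)
  then obtain S0 where S0: "S0 \<subseteq> (P - {q}) \<union> t ` H" "card S0 = K"
    and tr0: "transfer (\<lambda>u. N u + (\<Sum>h\<in>H. g h u)) (\<lambda>s. of_bool (s \<in> S0))"
    by blast
  let ?S = "S0 \<union> (\<Union>h\<in>H. S h)"
  have disj: "S h \<inter> S h' = {}" if "h \<in> H" "h' \<in> H" "h \<noteq> h'" for h h'
    using grp(1)[OF that(1)] grp(1)[OF that(2)] that(3) by (auto simp: J_def)
  have disj0: "S0 \<inter> S h = {}" if "h \<in> H" for h
  proof -
    have "t h' \<notin> S h" if "h' \<in> H" for h'
      using grp(2)[OF that] grp(1)[OF \<open>h \<in> H\<close>] hub_t(1)[OF that] by (auto simp: J_def)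
    moreover have "S h \<inter> P = {}" using grp(1)[OF that] I by (auto simp: J_def)
    ultimately show ?thesis using S0 by blast
  qed
  have finS: "finite (S h)" if "h \<in> H" for h using grp(1)[OF that] finJ finite_subset by blast
  have finS0: "finite S0" using S0 finH finP finite_subset by blast
  have "J h \<subseteq> I" for h by (auto simp: J_def)
  then have "?S \<subseteq> I \<union> (P - {q})"
    using S0 hub_t(2) grp(1) by blast
  moreover have "real (card ?S) = M + (\<Sum>s\<in>I. sum (m s) V) - e"
  proof -
    have "card (\<Union>h\<in>H. S h) = (\<Sum>h\<in>H. card (S h))"
      using finH finS disj by (intro card_UN_disjoint) auto
    moreover have "card ?S = card S0 + card (\<Union>h\<in>H. S h)"
      using finS0 finH finS disj0 by (intro card_Un_disjoint) auto
    ultimately have "real (card ?S) = real K + real (\<Sum>h\<in>H. card (S h))"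
      using S0 by simp
    also have "\<dots> = T - e"
      using K sumN sumcard by (simp add: T_def)
    finally show ?thesis
      using regroup[of "\<lambda>s. sum (m s) V"] by (simp add: T_def G_def)
  qed
  moreover have "transfer (\<lambda>u. N u + (\<Sum>s\<in>I. m s u)) (\<lambda>s. of_bool (s \<in> ?S))"
  proof (rule transfer_cong[THEN iffD1, OF _ _ transfer_add[OF tr0 transfer_sum[OF finH trS]]])
    fix u
    have "g h u + (1 - r h / G h) * (\<Sum>s\<in>J h. m s u) = (\<Sum>s\<in>J h. m s u)" for h
      by (simp add: g_def left_diff_distrib)
    then show "N u + (\<Sum>h\<in>H. g h u) + (\<Sum>h\<in>H. (1 - r h / G h) * (\<Sum>s\<in>J h. m s u)) = N u + (\<Sum>s\<in>I. m s u)"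
      using regroup[of "\<lambda>s. m s u"] by (simp add: add.assoc sum.distrib[symmetric])
  next
    fix s
    have "(\<Sum>h\<in>H. of_bool (s \<in> S h)) = (of_bool (s \<in> (\<Union>h\<in>H. S h)) :: real)"
    proof (cases "s \<in> (\<Union>h\<in>H. S h)")
      case True
      then obtain h where h: "h \<in> H" "s \<in> S h" by blast
      have "(\<Sum>h'\<in>H. of_bool (s \<in> S h')) = (\<Sum>h'\<in>H. if h' = h then 1 else (0 :: real))"
      proof (rule sum.cong[OF refl])
        fix h' assume "h' \<in> H"
        then show "of_bool (s \<in> S h') = (if h' = h then 1 else (0 :: real))"
          using disj[OF h(1), of h'] h(2) by auto
      qed
      then show ?thesis using True h finH by simp
    qed (auto intro: sum.neutral)
    then show "of_bool (s \<in> S0) + (\<Sum>h\<in>H. of_bool (s \<in> S h)) = (of_bool (s \<in> ?S) :: real)"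
      using disj0 by auto
  qed
  ultimately show ?thesis
    using e unfolding N_def M_def by blast
qed

section \<open>The tree of centers and the sweep\<close>

definition nb :: "'a \<Rightarrow> 'a set" where
  "nb v = {u \<in> F. nearby 1 u v}"

definition cover :: "'a list \<Rightarrow> 'a set" where
  "cover ps = (\<Union>p\<in>set ps. nb p)"

text \<open>The head of the list is the center added last, so that its own item can be handed on to the tail.\<close>

fun tree_order :: "'a list \<Rightarrow> bool" where
  "tree_order [] \<longleftrightarrow> True"
| "tree_order (p # ps) \<longleftrightarrow> tree_order ps \<and> p \<in> V \<and> nb p \<inter> cover ps = {} \<and>
     (ps = [] \<or> (\<exists>h\<in>cover ps. nearby 2 p h))"

lemma cover_Cons: "cover (p # ps) = nb p \<union> cover ps"
  by (simp add: cover_def)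

lemma nb_subset: "nb p \<subseteq> V" and cover_subset: "cover ps \<subseteq> V"
  using F_subset by (auto simp: nb_def cover_def)

text \<open>This is the only place where the absence of edges outside \<open>F\<close> is used.\<close>

lemma export_site:
  assumes "h \<in> F" "nearby 2 p h" "p \<in> V"
  shows "\<exists>q\<in>nb p. nearby 2 q h"
proof (cases "p \<in> F")
  case True
  then show ?thesis using assms nearby_refl by (auto simp: nb_def)
next
  case False
  obtain w where w: "nearby 1 p w" "nearby 1 w h"
    using assms(2) nearby_Suc[of 1 p h] by (auto simp: numeral_2_eq_2)
  show ?thesis
  proof (cases "p = w")
    case True
    then show ?thesis
      using w assms nearby_refl nearby_sym[of 1 h p] by (auto simp: nb_def intro!: bexI[of _ h])
  next
    case neq: False
    then have "w \<in> F" using w(1)[unfolded nearby_1] edge_F False by blast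
    then have "w \<in> nb p" using w(1) nearby_sym[of 1 w p] by (simp add: nb_def)
    then show ?thesis using w(2) nearby_mono[of 1 w h 2] by auto
  qed
qed

text \<open>The items in \<open>I\<close> are those handed on by centers already processed, so the
  induction must start from arbitrary ones. Every center opens exactly its total minus the export,
  and only the root rounds up; this is why the excess stays below 1 for the whole tree.\<close>

lemma tree_rounding:
  assumes y: "\<And>u. u \<in> F \<Longrightarrow> 0 \<le> y u" "\<And>u. u \<in> F \<Longrightarrow> y u \<le> 1" "\<And>v. v \<in> V \<Longrightarrow> 1 \<le> sum y (nb v)"
  shows "tree_order ps \<Longrightarrow> ps \<noteq> [] \<Longrightarrow> finite I \<Longrightarrow> I \<subseteq> V \<Longrightarrow> I \<inter> cover ps = {} \<Longrightarrow>
    (\<And>s. s \<in> I \<Longrightarrow> hub s \<in> cover ps) \<Longrightarrow> (\<And>s. s \<in> I \<Longrightarrow> nearby 2 s (hub s)) \<Longrightarrow>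
    (\<And>s u. s \<in> I \<Longrightarrow> u \<in> V \<Longrightarrow> 0 \<le> m s u) \<Longrightarrow>
    (\<And>s u. s \<in> I \<Longrightarrow> u \<in> V \<Longrightarrow> m s u > 0 \<Longrightarrow> nearby 3 u (hub s)) \<Longrightarrow>
    (\<And>s. s \<in> I \<Longrightarrow> 0 < sum (m s) V) \<Longrightarrow> (\<And>s. s \<in> I \<Longrightarrow> sum (m s) V \<le> 1) \<Longrightarrow>
    \<exists>S. S \<subseteq> I \<union> cover ps \<and> real (card S) < sum y (cover ps) + (\<Sum>s\<in>I. sum (m s) V) + 1 \<and>
      transfer (\<lambda>u. (if u \<in> cover ps then y u else 0) + (\<Sum>s\<in>I. m s u)) (\<lambda>s. of_bool (s \<in> S))"
proof (induction ps arbitrary: I hub m)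
  case (Cons p ps)
  let ?P = "nb p"
  define I1 where "I1 = {s \<in> I. hub s \<in> ?P}"
  define I2 where "I2 = I - I1"
  have p: "p \<in> V" "?P \<inter> cover ps = {}" "tree_order ps" using Cons.prems(1) by auto
  have P: "?P \<subseteq> F" "\<And>u. u \<in> ?P \<Longrightarrow> nearby 1 u p" by (auto simp: nb_def)
  have finP: "finite ?P" and fincov: "finite (cover ps)"
    by (rule finite_subset[OF nb_subset finite_V], rule finite_subset[OF cover_subset finite_V])
  have M: "1 \<le> sum y ?P" using y(3) p(1) by blast
  have I12: "finite I1" "finite I2" "I1 \<inter> I2 = {}" "I = I1 \<union> I2"
    using Cons.prems(3) by (auto simp: I1_def I2_def)
  have split_I: "(\<Sum>s\<in>I. f s) = (\<Sum>s\<in>I1. f s) + (\<Sum>s\<in>I2. f s)" for f :: "'a \<Rightarrow> real"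
    using I12 by (simp add: sum.union_disjoint)
  have sum_cov: "sum y (cover (p # ps)) = sum y ?P + sum y (cover ps)"
    using finP fincov p(2) by (simp add: cover_Cons sum.union_disjoint)
  have local: "\<exists>S e. S \<subseteq> I1 \<union> (?P - {q}) \<and> 0 < e \<and> e \<le> 1 \<and>
    real (card S) = sum y ?P + (\<Sum>s\<in>I1. sum (m s) V) - e \<and>
    transfer (\<lambda>u. (1 - e / sum y ?P) * (if u \<in> ?P then y u else 0) + (\<Sum>s\<in>I1. m s u))
      (\<lambda>s. of_bool (s \<in> S))" if "q \<in> ?P" for q
  proof (rule center_rounding[OF nb_subset that P(2), where hub = hub])
    show "finite I1" by fact
    show "I1 \<subseteq> V" "I1 \<inter> ?P = {}" using Cons.prems(4,5) I12 by (auto simp: cover_Cons)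
    fix s assume "s \<in> I1"
    then have s: "s \<in> I" by (simp add: I1_def)
    show "hub s \<in> ?P" using \<open>s \<in> I1\<close> by (simp add: I1_def)
    show "nearby 2 s (hub s)" "0 < sum (m s) V" "sum (m s) V \<le> 1" by (fact Cons.prems(7,10,11)[OF s])+
    show "0 \<le> m s u" "m s u > 0 \<Longrightarrow> nearby 3 u (hub s)" if "u \<in> V" for u
      by (fact Cons.prems(8,9)[OF s that])+
  qed (use P(1) y(1,2) M in auto)
  define \<mu> where "\<mu> e u = e / sum y ?P * (if u \<in> ?P then y u else 0)" for e u
  have sum_\<mu>: "sum (\<mu> e) V = e" for e
  proof -
    have "sum (\<mu> e) V = e / sum y ?P * (\<Sum>u\<in>V. if u \<in> ?P then y u else 0)"
      unfolding \<mu>_def by (simp add: sum_distrib_left)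
    also have "(\<Sum>u\<in>V. if u \<in> ?P then y u else 0) = sum y ?P"
      using nb_subset finite_V by (simp add: sum.inter_restrict[symmetric] Int_absorb1)
    finally show ?thesis using M by simp
  qed
  have \<mu>_nonneg: "0 \<le> \<mu> e u" if "0 < e" for e u
    using that y(1) P(1) M by (auto simp: \<mu>_def)
  have \<mu>_pos: "u \<in> ?P" if "0 < \<mu> e u" for e u
    using that by (auto simp: \<mu>_def split: if_splits)
  have split_P: "(1 - e / sum y ?P) * (if u \<in> ?P then y u else 0) + \<mu> e u = (if u \<in> ?P then y u else 0)" for e u
    by (simp add: \<mu>_def left_diff_distrib)
  show ?case
  proof (cases "ps = []")
    case True
    then have "I2 = {}" "cover ps = {}"
      using Cons.prems(6) by (auto simp: I1_def I2_def cover_def)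
    obtain q where q: "q \<in> ?P" using M by (cases "?P = {}") auto
    from local[OF q] obtain S e where S: "S \<subseteq> I1 \<union> (?P - {q})" and e: "0 < e" "e \<le> 1"
      and cardS: "real (card S) = sum y ?P + (\<Sum>s\<in>I1. sum (m s) V) - e"
      and trS: "transfer (\<lambda>u. (1 - e / sum y ?P) * (if u \<in> ?P then y u else 0) + (\<Sum>s\<in>I1. m s u))
      (\<lambda>s. of_bool (s \<in> S))" by blast
    have "q \<in> V" using q nb_subset by blast
    have "q \<notin> I" using Cons.prems(5) q by (auto simp: cover_Cons)
    then have "q \<notin> S" using S I12 by auto
    have finS: "finite S" using S I12 finP finite_subset[of S] by auto
    \<comment> \<open>The root has no hub to export to, so its last remainder is absorbed by opening
      \<open>q\<close> itself, at distance 1 + 1.\<close>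
    have trq: "transfer (\<mu> e) (\<lambda>s. of_bool (s = q))"
    proof (rule transfer_complete)
      show "sum (\<mu> e) V \<le> (\<Sum>s\<in>V. of_bool (s = q))"
        using sum_\<mu> e sum_of_bool_card[of "{q}"] \<open>q \<in> V\<close> by simp
    next
      fix u s assume "0 < \<mu> e u" "(0::real) < of_bool (s = q)"
      then have "s = q" "nearby 1 u p" using \<mu>_pos P(2) by auto
      moreover have "nearby 1 p q" using q P(2) nearby_sym by blast
      ultimately show "nearby 5 u s" using nearby_le[of 1 u p 1 q 5] by simp
    qed (use \<mu>_nonneg e in auto)
    have "transfer (\<lambda>u. (if u \<in> cover (p # ps) then y u else 0) + (\<Sum>s\<in>I. m s u)) (\<lambda>s. of_bool (s \<in> insert q S))"
    proof (rule transfer_cong[THEN iffD1, OF _ _ transfer_add[OF trS trq]])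
      fix u
      show "(1 - e / sum y ?P) * (if u \<in> ?P then y u else 0) + (\<Sum>s\<in>I1. m s u) + \<mu> e u =
        (if u \<in> cover (p # ps) then y u else 0) + (\<Sum>s\<in>I. m s u)"
        using split_P[of e u] split_I[of "\<lambda>s. m s u"] \<open>I2 = {}\<close> \<open>cover ps = {}\<close> by (simp add: cover_Cons)
    qed (use \<open>q \<notin> S\<close> in auto)
    moreover have "real (card (insert q S)) < sum y (cover (p # ps)) + (\<Sum>s\<in>I. sum (m s) V) + 1"
      using cardS e finS \<open>q \<notin> S\<close> \<open>I2 = {}\<close> \<open>cover ps = {}\<close> by (simp add: sum_cov split_I)
    moreover have "insert q S \<subseteq> I \<union> cover (p # ps)"
      using S q I12 by (auto simp: cover_Cons)
    ultimately show ?thesis by blast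
  next
    case False
    then obtain h where h: "h \<in> cover ps" "nearby 2 p h" using Cons.prems(1) by auto
    then have "h \<in> F" by (auto simp: cover_def nb_def)
    then obtain q where q: "q \<in> ?P" "nearby 2 q h" using export_site h(2) p(1) by blast
    from local[OF q(1)] obtain S e where S: "S \<subseteq> I1 \<union> (?P - {q})" and e: "0 < e" "e \<le> 1"
      and cardS: "real (card S) = sum y ?P + (\<Sum>s\<in>I1. sum (m s) V) - e"
      and trS: "transfer (\<lambda>u. (1 - e / sum y ?P) * (if u \<in> ?P then y u else 0) + (\<Sum>s\<in>I1. m s u))
      (\<lambda>s. of_bool (s \<in> S))" by blast
    have "q \<notin> I" using Cons.prems(5) q by (auto simp: cover_Cons)
    then have "q \<notin> I2" using I12 by auto
    \<comment> \<open>The export becomes an item of the remaining tree with site \<open>q\<close>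
      and hub \<open>h\<close>. Its mass is within 1 + 2 of \<open>h\<close>, so the invariant on
      distances is restored.\<close>
    let ?m = "m(q := \<mu> e)" and ?hub = "hub(q := h)"
    have upd: "?m s = m s" "?hub s = hub s" if "s \<in> I2" for s using that \<open>q \<notin> I2\<close> by auto
    have sum_upd: "(\<Sum>s\<in>insert q I2. f (?m s)) = f (\<mu> e) + (\<Sum>s\<in>I2. f (m s))" for f :: "('a \<Rightarrow> real) \<Rightarrow> real"
    proof -
      have "(\<Sum>s\<in>I2. f (?m s)) = (\<Sum>s\<in>I2. f (m s))"
        using upd(1) by (intro sum.cong) auto
      then show ?thesis using \<open>q \<notin> I2\<close> I12(2) by simp
    qed
    have \<mu>_near: "nearby 3 u h" if "0 < \<mu> e u" for u
      using nearby_le[OF P(2)[OF \<mu>_pos[OF that]] h(2)] by simp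
    have "\<exists>S'. S' \<subseteq> insert q I2 \<union> cover ps \<and>
      real (card S') < sum y (cover ps) + (\<Sum>s\<in>insert q I2. sum (?m s) V) + 1 \<and>
      transfer (\<lambda>u. (if u \<in> cover ps then y u else 0) + (\<Sum>s\<in>insert q I2. ?m s u)) (\<lambda>s. of_bool (s \<in> S'))"
    proof (rule Cons.IH[OF p(3) False, where hub = ?hub])
      show "finite (insert q I2)" using I12 by simp
      show "insert q I2 \<subseteq> V" using q nb_subset Cons.prems(4) I12 by blast
      show "insert q I2 \<inter> cover ps = {}" using q p(2) Cons.prems(5) I12 by (auto simp: cover_Cons)
      fix s assume s: "s \<in> insert q I2"
      show "?hub s \<in> cover ps"
        using s h(1) Cons.prems(6) by (auto simp: I2_def I1_def cover_Cons)
      show "nearby 2 s (?hub s)"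
        using s q(2) Cons.prems(7) I12 by auto
      show "0 < sum (?m s) V"
        using s sum_\<mu> e Cons.prems(10) I12 by auto
      show "sum (?m s) V \<le> 1"
        using s sum_\<mu> e Cons.prems(11) I12 by auto
      fix u assume u: "u \<in> V"
      show "0 \<le> ?m s u"
        using s u \<mu>_nonneg e Cons.prems(8) I12 by auto
      show "nearby 3 u (?hub s)" if "0 < ?m s u"
        using that s u \<mu>_near Cons.prems(9) I12 by (auto split: if_splits)
    qed
    then obtain S' where S': "S' \<subseteq> insert q I2 \<union> cover ps"
      and cardS': "real (card S') < sum y (cover ps) + (\<Sum>s\<in>insert q I2. sum (?m s) V) + 1"
      and trS': "transfer (\<lambda>u. (if u \<in> cover ps then y u else 0) + (\<Sum>s\<in>insert q I2. ?m s u)) (\<lambda>s. of_bool (s \<in> S'))"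
      by blast
    have "S \<inter> S' = {}"
      using S S' q(1) p(2) Cons.prems(5) I12 unfolding cover_Cons by blast
    have "real (card (S \<union> S')) \<le> real (card S) + real (card S')"
      using card_Un_le[of S S'] by linarith
    also have "\<dots> < sum y (cover (p # ps)) + (\<Sum>s\<in>I. sum (m s) V) + 1"
      using cardS cardS' sum_upd[of "\<lambda>f. sum f V"] by (simp add: sum_cov split_I sum_\<mu>)
    finally have "real (card (S \<union> S')) < sum y (cover (p # ps)) + (\<Sum>s\<in>I. sum (m s) V) + 1" .
    moreover have "S \<union> S' \<subseteq> I \<union> cover (p # ps)"
      using S S' q(1) I12 by (auto simp: cover_Cons)
    moreover have "transfer (\<lambda>u. (if u \<in> cover (p # ps) then y u else 0) + (\<Sum>s\<in>I. m s u)) (\<lambda>s. of_bool (s \<in> S \<union> S'))"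
    proof (rule transfer_cong[THEN iffD1, OF _ _ transfer_add[OF trS trS']])
      fix u
      have "(if u \<in> cover (p # ps) then y u else 0) = (if u \<in> ?P then y u else 0) + (if u \<in> cover ps then y u else 0)"
        using p(2) by (auto simp: cover_Cons)
      then show "(1 - e / sum y ?P) * (if u \<in> ?P then y u else 0) + (\<Sum>s\<in>I1. m s u) +
          ((if u \<in> cover ps then y u else 0) + (\<Sum>s\<in>insert q I2. ?m s u)) =
        (if u \<in> cover (p # ps) then y u else 0) + (\<Sum>s\<in>I. m s u)"
        using split_P[of e u] split_I[of "\<lambda>s. m s u"] sum_upd[of "\<lambda>f. f u"] by linarith
    qed (use \<open>S \<inter> S' = {}\<close> in auto)
    ultimately show ?thesis by blast
  qed
qed simp

text \<open>Centers have nonempty, pairwise disjoint sets \<open>nb\<close> and are therefore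
  distinct, so a longest list exists. A vertex within 2 of a covered facility could be added to it
  unless its own \<open>nb\<close> meets the cover; hence it is within 1 of the cover. Along a walk
  starting at a center this property passes from each vertex to the next.\<close>

lemma maximal_tree_order:
  assumes "\<And>v. v \<in> V \<Longrightarrow> nb v \<noteq> {}" "V \<noteq> {}" and conn: "\<And>u v. u \<in> V \<Longrightarrow> v \<in> V \<Longrightarrow> (u, v) \<in> E\<^sup>*"
  obtains ps where "tree_order ps" "ps \<noteq> []" "\<And>v. v \<in> V \<Longrightarrow> \<exists>h\<in>cover ps. nearby 1 v h"
proof -
  have bound: "length ps \<le> card V" if "tree_order ps" for ps
  proof -
    have "set ps \<subseteq> V \<and> distinct ps"
      using that
    proof (induction ps)
      case (Cons p ps)
      then have "nb p \<noteq> {}" using assms(1) by simp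
      with Cons show ?case by (auto simp: cover_def)
    qed simp
    then show ?thesis
      using finite_V by (metis card_mono distinct_card)
  qed
  obtain p where p: "p \<in> V" using assms(2) by blast
  have "\<exists>ps. tree_order ps \<and> ps \<noteq> []"
    using p by (intro exI[of _ "[p]"]) (simp add: cover_def)
  then obtain ps where ps: "tree_order ps" "ps \<noteq> []"
    and max: "\<And>ps'. tree_order ps' \<Longrightarrow> ps' \<noteq> [] \<Longrightarrow> length ps' \<le> length ps"
    using ex_has_greatest_nat[of "\<lambda>ps. tree_order ps \<and> ps \<noteq> []" _ length "Suc (card V)"] bound
    by (metis (no_types, lifting) le_imp_less_Suc)
  have near: "\<exists>h\<in>cover ps. nearby 1 v h" if "v \<in> V" "h \<in> cover ps" "nearby 2 v h" for v h
  proof -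
    have "nb v \<inter> cover ps \<noteq> {}"
      using max[of "v # ps"] ps that by auto
    then show ?thesis by (auto simp: nb_def nearby_sym)
  qed
  obtain r where r: "r \<in> set ps" "r \<in> V"
    using ps by (cases ps) auto
  obtain h0 where "h0 \<in> nb r" using assms(1) r(2) by blast
  then have r_near: "\<exists>h\<in>cover ps. nearby 1 r h"
    using r(1) nearby_sym[of 1 r h0] by (auto simp: nb_def cover_def)
  have "\<exists>h\<in>cover ps. nearby 1 v h" if "v \<in> V" for v
    using conn[OF r(2) that] that
  proof (induction rule: rtrancl_induct)
    case (step u v)
    then have "u \<in> V" using E_subset by blast
    then obtain h where h: "h \<in> cover ps" "nearby 1 u h" using step by blast
    have "nearby 1 v u" using step.hyps(2) nearby_1[of u v] nearby_sym[of 1 u v] by simp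
    then have "nearby 2 v h" using h(2) nearby_le[of 1 v u 1 h 2] by simp
    then show ?case using near step.prems h by blast
  qed (rule r_near)
  with ps show ?thesis using that by blast
qed

text \<open>Facilities outside the cover are treated as initial items: each carries its own opening,
  is its own site, and has a covered facility next to it as hub. Those with opening 0 are left out
  because items must have positive mass.\<close>

lemma integral_transfer:
  assumes y: "\<And>u. u \<in> F \<Longrightarrow> 0 \<le> y u" "\<And>u. u \<in> F \<Longrightarrow> y u \<le> 1" "\<And>v. v \<in> V \<Longrightarrow> 1 \<le> sum y (nb v)"
    and "V \<noteq> {}" "\<And>u v. u \<in> V \<Longrightarrow> v \<in> V \<Longrightarrow> (u, v) \<in> E\<^sup>*"
  shows "\<exists>S\<subseteq>F. real (card S) < sum y F + 1 \<and>
    transfer (\<lambda>u. if u \<in> F then y u else 0) (\<lambda>s. of_bool (s \<in> S))"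
proof -
  have "nb v \<noteq> {}" if "v \<in> V" for v using y(3)[OF that] by auto
  then obtain ps where ps: "tree_order ps" "ps \<noteq> []" "\<And>v. v \<in> V \<Longrightarrow> \<exists>h\<in>cover ps. nearby 1 v h"
    using maximal_tree_order[OF _ assms(4,5)] by blast
  then obtain hub where hub: "\<And>v. v \<in> V \<Longrightarrow> hub v \<in> cover ps" "\<And>v. v \<in> V \<Longrightarrow> nearby 1 v (hub v)"
    by metis
  let ?C = "cover ps"
  define I where "I = {u \<in> F - ?C. y u > 0}"
  define m where "m s u = (if u = s then y s else 0)" for s u
  have "?C \<subseteq> F" by (auto simp: cover_def nb_def)
  have finF: "finite F" using finite_V F_subset finite_subset by blast
  have "I \<subseteq> V" using F_subset by (auto simp: I_def)
  have sum_m: "sum (m s) V = y s" if "s \<in> I" for s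
    using that \<open>I \<subseteq> V\<close> finite_V by (auto simp: m_def)
  have "\<exists>S. S \<subseteq> I \<union> ?C \<and> real (card S) < sum y ?C + (\<Sum>s\<in>I. sum (m s) V) + 1 \<and>
      transfer (\<lambda>u. (if u \<in> ?C then y u else 0) + (\<Sum>s\<in>I. m s u)) (\<lambda>s. of_bool (s \<in> S))"
  proof (rule tree_rounding[OF y ps(1,2), where hub = hub])
    fix s assume s: "s \<in> I"
    then have "s \<in> V" using \<open>I \<subseteq> V\<close> by blast
    show "hub s \<in> ?C" using hub \<open>s \<in> V\<close> by blast
    show "nearby 2 s (hub s)" using nearby_mono[OF hub(2)[OF \<open>s \<in> V\<close>]] by simp
    show "0 < sum (m s) V" "sum (m s) V \<le> 1" using sum_m s y by (auto simp: I_def)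
    fix u
    show "0 \<le> m s u" using s y by (auto simp: m_def I_def)
    show "nearby 3 u (hub s)" if "m s u > 0"
      using that nearby_mono[OF hub(2)[OF \<open>s \<in> V\<close>], of 3] by (auto simp: m_def split: if_splits)
  qed (use \<open>I \<subseteq> V\<close> finF in \<open>auto simp: I_def\<close>)
  then obtain S where S: "S \<subseteq> I \<union> ?C" "real (card S) < sum y ?C + (\<Sum>s\<in>I. sum (m s) V) + 1"
    and tr: "transfer (\<lambda>u. (if u \<in> ?C then y u else 0) + (\<Sum>s\<in>I. m s u)) (\<lambda>s. of_bool (s \<in> S))"
    by blast
  have sum_I: "(\<Sum>s\<in>I. m s u) = (if u \<in> I then y u else 0)" for u
    using finF by (simp add: m_def I_def)
  have "transfer (\<lambda>u. if u \<in> F then y u else 0) (\<lambda>s. of_bool (s \<in> S))"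
  proof (rule transfer_cong[THEN iffD1, OF _ _ tr])
    fix u
    have "y u = 0" if "u \<in> F - ?C - I" using that y(1)[of u] by (auto simp: I_def)
    then show "(if u \<in> ?C then y u else 0) + (\<Sum>s\<in>I. m s u) = (if u \<in> F then y u else 0)"
      using \<open>?C \<subseteq> F\<close> unfolding sum_I by (auto simp: I_def)
  qed simp
  moreover have "sum y ?C + (\<Sum>s\<in>I. sum (m s) V) = sum y F"
  proof -
    have "(\<Sum>s\<in>I. sum (m s) V) = sum y (F - ?C)"
      using sum_m finF y(1) by (intro sum.mono_neutral_cong_left) (force simp: I_def)+
    then show ?thesis using finF \<open>?C \<subseteq> F\<close> by (simp add: sum_diff)
  qed
  moreover have "S \<subseteq> F" using S(1) \<open>?C \<subseteq> F\<close> by (auto simp: I_def)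
  ultimately show ?thesis using S(2) by auto
qed

end

section \<open>Hall's theorem\<close>

text \<open>The Halmos-Vaughan induction. A tight nonempty proper subset is matched first, and the
  others are matched outside its neighbourhood. If no such subset is tight, each has a neighbour to
  spare, so any one pair can be fixed and its target deleted.\<close>

lemma hall:
  assumes "finite W" "\<And>w. w \<in> W \<Longrightarrow> finite (A w)" "\<And>U. U \<subseteq> W \<Longrightarrow> card U \<le> card (\<Union>(A ` U))"
  shows "\<exists>f. inj_on f W \<and> (\<forall>w\<in>W. f w \<in> A w)"
  using assms
proof (induction "card W" arbitrary: W A rule: less_induct)
  case less
  note fin = less.prems(1,2) and cond = less.prems(3)
  show ?case
  proof (cases "\<exists>U. U \<subset> W \<and> U \<noteq> {} \<and> card (\<Union>(A ` U)) \<le> card U")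
    case True
    then obtain U where U: "U \<subset> W" "U \<noteq> {}" "card (\<Union>(A ` U)) \<le> card U" by blast
    let ?X = "\<Union>(A ` U)"
    have finU: "finite U" using U fin(1) finite_subset by blast
    have finX: "finite ?X" using U finU fin(2) by auto
    have "\<exists>f. inj_on f U \<and> (\<forall>w\<in>U. f w \<in> A w)"
    proof (rule less.hyps[OF psubset_card_mono[OF fin(1) U(1)] finU])
      show "finite (A w)" if "w \<in> U" for w using that fin(2) U(1) by blast
      show "card U' \<le> card (\<Union>(A ` U'))" if "U' \<subseteq> U" for U'
        using that U(1) by (intro cond) blast
    qed
    then obtain f where f: "inj_on f U" "\<forall>w\<in>U. f w \<in> A w" by blast
    have "\<exists>g. inj_on g (W - U) \<and> (\<forall>w\<in>W - U. g w \<in> A w - ?X)"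
    proof (rule less.hyps)
      show "card (W - U) < card W"
        using U fin(1) by (intro psubset_card_mono) auto
      fix U' assume U': "U' \<subseteq> W - U"
      then have finU': "finite U'" using fin(1) finite_subset by blast
      have finX': "finite (\<Union>(A ` U'))" using finU' U' fin(2) by auto
      \<comment> \<open>The condition for \<open>U \<union> U'\<close> minus the tightness of
        \<open>U\<close> gives the condition for \<open>U'\<close> outside
        \<open>?X\<close>.\<close>
      have "card U + card U' = card (U \<union> U')"
        using U' finU finU' by (subst card_Un_disjoint) auto
      also have "\<dots> \<le> card (\<Union>(A ` (U \<union> U')))"
        using U U' by (intro cond) auto
      also have "\<Union>(A ` (U \<union> U')) = ?X \<union> (\<Union>w\<in>U'. A w - ?X)" by auto
      also have "card \<dots> \<le> card ?X + card (\<Union>w\<in>U'. A w - ?X)"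
        by (rule card_Un_le)
      finally show "card U' \<le> card (\<Union>w\<in>U'. A w - ?X)" using U(3) by linarith
    qed (use fin in auto)
    then obtain g where g: "inj_on g (W - U)" "\<forall>w\<in>W - U. g w \<in> A w - ?X" by blast
    let ?h = "\<lambda>w. if w \<in> U then f w else g w"
    have "inj_on ?h (U \<union> (W - U))"
      unfolding inj_on_Un
    proof (intro conjI)
      show "inj_on ?h U" using f(1) by (simp cong: inj_on_cong)
      show "inj_on ?h (W - U)" using g(1) by (auto simp: inj_on_def)
      show "?h ` (U - (W - U)) \<inter> ?h ` (W - U - U) = {}" using f(2) g(2) by fastforce
    qed
    then have "inj_on ?h W" using U(1) by (simp add: Un_absorb1 psubset_imp_subset)
    moreover have "\<forall>w\<in>W. ?h w \<in> A w" using f(2) g(2) by auto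
    ultimately show ?thesis by blast
  next
    case proper: False
    show ?thesis
    proof (cases "W = {}")
      case neq: False
      then obtain w where w: "w \<in> W" by blast
      have "card {w} \<le> card (\<Union>(A ` {w}))" using w by (intro cond) auto
      then obtain a where a: "a \<in> A w" by (cases "A w = {}") auto
      have "\<exists>f. inj_on f (W - {w}) \<and> (\<forall>v\<in>W - {w}. f v \<in> A v - {a})"
      proof (rule less.hyps)
        show "card (W - {w}) < card W"
          using w fin(1) by (intro psubset_card_mono) auto
        fix U assume U: "U \<subseteq> W - {w}"
        show "card U \<le> card (\<Union>v\<in>U. A v - {a})"
        proof (cases "U = {}")
          case False
          moreover have "U \<subset> W" using U w by blast
          ultimately have "card U < card (\<Union>(A ` U))"
            using proper not_le by blast
          also have "\<dots> \<le> card (insert a (\<Union>v\<in>U. A v - {a}))"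
            using U fin finite_subset[of U W] by (intro card_mono) auto
          also have "\<dots> \<le> Suc (card (\<Union>v\<in>U. A v - {a}))"
            by (rule card_insert_le_m1) auto
          finally show ?thesis by simp
        qed simp
      qed (use fin in auto)
      then obtain f where f: "inj_on f (W - {w})" "\<forall>v\<in>W - {w}. f v \<in> A v - {a}" by blast
      have "inj_on (f(w := a)) (insert w (W - {w}))"
        unfolding inj_on_insert
      proof
        show "inj_on (f(w := a)) (W - {w})"
          by (rule inj_on_cong[THEN iffD1, OF _ f(1)]) simp
        show "(f(w := a)) w \<notin> (f(w := a)) ` (W - {w} - {w})" using f(2) by auto
      qed
      then have "inj_on (f(w := a)) W" using w by (simp add: insert_absorb)
      moreover have "\<forall>v\<in>W. (f(w := a)) v \<in> A v" using f a by auto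
      ultimately show ?thesis by blast
    qed auto
  qed
qed

text \<open>Every sink is split into \<open>L\<close> slots, and the slot is forgotten after an
  injective choice.\<close>

lemma hall_capacitated:
  assumes "finite W" "\<And>w. w \<in> W \<Longrightarrow> finite (N w)"
    and "\<And>U. U \<subseteq> W \<Longrightarrow> card U \<le> L * card (\<Union>(N ` U))"
  shows "\<exists>\<phi>. (\<forall>w\<in>W. \<phi> w \<in> N w) \<and> (\<forall>s. card {w \<in> W. \<phi> w = s} \<le> L)"
proof -
  have "\<exists>f. inj_on f W \<and> (\<forall>w\<in>W. f w \<in> N w \<times> {..<L})"
  proof (rule hall)
    fix U assume "U \<subseteq> W"
    moreover have "(\<Union>w\<in>U. N w \<times> {..<L}) = \<Union>(N ` U) \<times> {..<L}" by auto
    ultimately show "card U \<le> card (\<Union>w\<in>U. N w \<times> {..<L})"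
      using assms(3) by (simp add: card_cartesian_product mult.commute)
  qed (use assms in auto)
  then obtain f where f: "inj_on f W" "\<forall>w\<in>W. f w \<in> N w \<times> {..<L}" by blast
  have "card {w \<in> W. fst (f w) = s} \<le> L" for s
  proof -
    have "card {w \<in> W. fst (f w) = s} \<le> card ({s} \<times> {..<L})"
    proof (rule card_inj_on_le)
      show "inj_on f {w \<in> W. fst (f w) = s}"
        using f(1) by (rule inj_on_subset) auto
      show "f ` {w \<in> W. fst (f w) = s} \<subseteq> {s} \<times> {..<L}"
        using f(2) by (auto simp: image_subset_iff mem_Times_iff)
    qed simp
    then show ?thesis by (simp add: card_cartesian_product)
  qed
  moreover have "\<forall>w\<in>W. fst (f w) \<in> N w" using f(2) by (auto simp: mem_Times_iff)
  ultimately show ?thesis by (intro exI[of _ "\<lambda>w. fst (f w)"]) blast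
qed

section \<open>Existence of a solution\<close>

lemma awalk_imp_relpow:
  assumes "wf_digraph H"
  shows "pre_digraph.awalk H u p v \<Longrightarrow> (u, v) \<in> (arcs_ends H \<union> Id) ^^ length p"
proof (induction p arbitrary: u)
  case Nil
  then show ?case using assms by (simp add: wf_digraph.awalk_Nil_iff)
next
  case (Cons e p)
  then have e: "e \<in> arcs H" "u = tail H e" "pre_digraph.awalk H (head H e) p v"
    using assms by (simp_all add: wf_digraph.awalk_Cons_iff)
  then have "(u, head H e) \<in> arcs_ends H \<union> Id" by (auto simp: arcs_ends_conv)
  then show ?case
    using relpow_Suc_I2[OF _ Cons.IH[OF e(3)]] by (simp del: relpow.simps)
qed

lemma relpow_imp_awalk:
  assumes "wf_digraph H" "v \<in> verts H"
  shows "(u, v) \<in> (arcs_ends H \<union> Id) ^^ n \<Longrightarrow> \<exists>p. pre_digraph.awalk H u p v \<and> length p \<le> n"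
proof (induction n arbitrary: u)
  case 0
  then show ?case using assms by (auto simp: wf_digraph.awalk_Nil_iff intro!: exI[of _ "[]"])
next
  case (Suc n)
  then obtain w where w: "(u, w) \<in> arcs_ends H \<union> Id" "(w, v) \<in> (arcs_ends H \<union> Id) ^^ n"
    by (meson relpow_Suc_D2)
  from Suc.IH[OF w(2)] obtain p where p: "pre_digraph.awalk H w p v" "length p \<le> n" by blast
  show ?case
  proof (cases "u = w")
    case True
    then show ?thesis using p by (auto intro: le_SucI)
  next
    case False
    then obtain e where "e \<in> arcs H" "tail H e = u" "head H e = w"
      using w(1) by (auto simp: arcs_ends_conv)
    then have "pre_digraph.awalk H u (e # p) v"
      using p(1) assms(1) by (simp add: wf_digraph.awalk_Cons_iff)
    then show ?thesis using p(2) by (intro exI[of _ "e # p"]) simp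
  qed
qed

lemma (in wf_digraph) awalk_cost_unit: "awalk_cost (\<lambda>_. 1) p = real (length p)"
  by (induction p) auto

lemma graph_dist_le_iff:
  assumes "wf_digraph H" "v \<in> verts H"
  shows "graph_dist H u v \<le> ereal (real n) \<longleftrightarrow> (u, v) \<in> (arcs_ends H \<union> Id) ^^ n"
proof
  interpret wf_digraph H by fact
  assume "(u, v) \<in> (arcs_ends H \<union> Id) ^^ n"
  from relpow_imp_awalk[OF assms this] obtain p where p: "awalk u p v" "length p \<le> n"
    by blast
  then show "graph_dist H u v \<le> ereal (real n)"
    using min_cost_le_walk_cost[OF p(1), of "\<lambda>_. 1"] by (simp add: graph_dist_def awalk_cost_unit order_trans)
next
  interpret wf_digraph H by fact
  assume "graph_dist H u v \<le> ereal (real n)"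
  \<comment> \<open>Only a strict bound on the infimum produces an actual walk; lengths are
    integers, so \<open>Suc n\<close> loses nothing.\<close>
  also have "\<dots> < ereal (real (Suc n))" by simp
  finally obtain p where p: "awalk u p v" "length p < Suc n"
    by (auto simp: graph_dist_def \<mu>_def INF_less_iff awalk_cost_unit)
  then have "(u, v) \<in> (arcs_ends H \<union> Id) ^^ length p"
    by (intro awalk_imp_relpow assms)
  moreover have "(v, v) \<in> (arcs_ends H \<union> Id) ^^ m" for m
    by (induction m) auto
  ultimately have "(u, v) \<in> (arcs_ends H \<union> Id) ^^ (length p + (n - length p))"
    unfolding relpow_add by (rule relcompI)
  then show "(u, v) \<in> (arcs_ends H \<union> Id) ^^ n" using p(2) by simp
qed

text \<open>Adding arcs on the same vertices preserves connectedness, so maximality forces all arcs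
  between the chosen vertices to be present.\<close>

lemma connected_component_induced:
  assumes "is_component G H"
  shows "induced_subgraph H G"
proof (rule pre_digraph.induced_subgraphI_arc_mono)
  show "pre_digraph.max_subgraph G Digraph_Component.connected H"
    using assms by (simp add: is_component_def)
  show "arc_mono (Digraph_Component.connected :: ('a, 'b) pre_digraph \<Rightarrow> bool)"
    unfolding arc_mono_def
    by (metis spanning_def subgraph_def wf_digraph.connected_spanning_imp_connected)
qed

lemma component_cap_graph:
  assumes inst: "zero_L_instance V c cap"
    and comp: "is_component (with_proj (remove_zero_edges cap (threshold_graph V c \<tau>))) H"
  shows "wf_digraph H" "verts H \<noteq> {}" "verts H \<subseteq> V"
    and "cap_graph (verts H) (arcs_ends H) {u \<in> verts H. cap u \<noteq> 0}"
    and "\<And>u v. u \<in> verts H \<Longrightarrow> v \<in> verts H \<Longrightarrow> (u, v) \<in> (arcs_ends H)\<^sup>*"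
proof -
  let ?G = "remove_zero_edges cap (threshold_graph V c \<tau>)"
  have ind: "induced_subgraph H ?G"
    using comp by (rule connected_component_induced)
  then have sub: "subgraph H ?G" by (simp add: induced_subgraph_def)
  then show "wf_digraph H" and "verts H \<subseteq> V"
    by (auto simp: subgraph_def remove_zero_edges_def threshold_graph_def)
  have conn: "Digraph_Component.connected H"
    using comp by (simp add: is_component_def pre_digraph.max_subgraph_def)
  then show "verts H \<noteq> {}"
    by (auto simp: connected_def strongly_connected_def mk_symmetric_def)
  have th: "tail H = fst" "head H = snd"
    using sub by (auto simp: subgraph_def compatible_def)
  have "arcs H = {e \<in> parcs ?G. fst e \<in> verts H \<and> snd e \<in> verts H}"
    using ind unfolding induced_subgraph_def by simp
  then have arcs: "(u, v) \<in> arcs_ends H \<longleftrightarrow> u \<in> verts H \<and> v \<in> verts H \<and> c u v \<le> \<tau> \<and> (cap u \<noteq> 0 \<or> cap v \<noteq> 0)" for u v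
    using \<open>verts H \<subseteq> V\<close> unfolding arcs_ends_conv th
    by (auto simp: remove_zero_edges_def threshold_graph_def)
  have "c u v = c v u" for u v
    using inst Metric_space.commute[of V c] unfolding zero_L_instance_def by blast
  then have sym: "sym (arcs_ends H)"
    using \<open>verts H \<subseteq> V\<close> by (intro symI) (auto simp: arcs subset_iff)
  have "finite V" using inst by (simp add: zero_L_instance_def)
  then show "cap_graph (verts H) (arcs_ends H) {u \<in> verts H. cap u \<noteq> 0}"
    using sym finite_subset[OF \<open>verts H \<subseteq> V\<close>]
    by unfold_locales (auto simp: arcs)
  show "(u, v) \<in> (arcs_ends H)\<^sup>*" if "u \<in> verts H" "v \<in> verts H" for u v
  proof -
    have "u \<rightarrow>\<^sup>*\<^bsub>with_proj (mk_symmetric H)\<^esub> v"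
      using conn that by (auto simp: connected_def strongly_connected_def mk_symmetric_def)
    then have "(u, v) \<in> (parcs (mk_symmetric H))\<^sup>*"
      using reachable_rtranclI by fastforce
    \<comment> \<open>Connectedness is defined through the symmetric closure, which adds nothing to
      symmetric arcs.\<close>
    also have "parcs (mk_symmetric H) = arcs_ends H"
      using sym by (auto simp: parcs_mk_symmetric arcs_ends_conv sym_def th)
    finally show ?thesis .
  qed
qed

section \<open>From the linear program to an assignment\<close>

lemma rounding_exists:
  assumes inst: "zero_L_instance V c cap"
    and comp: "is_component (with_proj (remove_zero_edges cap (threshold_graph V c \<tau>))) H"
    and LP: "LP_feasible k cap H"
  shows "\<exists>S \<phi>. is_solution 6 k cap H S \<phi>"
proof -
  let ?V = "verts H" and ?E = "arcs_ends H"
  define F where "F = {u \<in> ?V. cap u \<noteq> 0}"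
  note cg = component_cap_graph[OF inst comp]
  interpret cap_graph ?V ?E F unfolding F_def by (rule cg(4))
  have finF: "finite F" using finite_V by (simp add: F_def)
  from LP obtain x :: "'a \<Rightarrow> 'a \<Rightarrow> real" and y :: "'a \<Rightarrow> real"
    where total: "(\<Sum>u\<in>?V. y u) = of_int k"
    and xy: "\<And>u v. u \<in> ?V \<Longrightarrow> v \<in> ?V \<Longrightarrow> x u v \<le> y u"
    and load: "\<And>u. u \<in> ?V \<Longrightarrow> (\<Sum>v | v \<in> ?V \<and> (u, v) \<in> ?E. x u v) \<le> real (cap u) * y u"
    and serve: "\<And>v. v \<in> ?V \<Longrightarrow> (\<Sum>u | u \<in> ?V \<and> (u, v) \<in> ?E. x u v) = 1"
    and x: "\<And>u v. u \<in> ?V \<Longrightarrow> v \<in> ?V \<Longrightarrow> 0 \<le> x u v"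
    and y: "\<And>u. u \<in> ?V \<Longrightarrow> 0 \<le> y u" "\<And>u. u \<in> ?V \<Longrightarrow> y u \<le> 1"
    unfolding LP_feasible_def by blast
  have x0: "x u v = 0" if "u \<in> ?V - F" "v \<in> ?V" "(u, v) \<in> ?E" for u v
  proof -
    have "(\<Sum>v | v \<in> ?V \<and> (u, v) \<in> ?E. x u v) \<le> 0"
      using load[of u] that by (simp add: F_def)
    moreover have "x u v \<le> (\<Sum>v | v \<in> ?V \<and> (u, v) \<in> ?E. x u v)"
      using that x finite_V by (intro member_le_sum) auto
    ultimately show ?thesis using x[of u v] that by simp
  qed
  have serveF: "(\<Sum>u | u \<in> F \<and> (u, v) \<in> ?E. x u v) = 1" if "v \<in> ?V" for v
  proof -
    have "(\<Sum>u | u \<in> F \<and> (u, v) \<in> ?E. x u v) = (\<Sum>u | u \<in> ?V \<and> (u, v) \<in> ?E. x u v)"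
      using x0 that finite_V by (intro sum.mono_neutral_left) (auto simp: F_def)
    then show ?thesis using serve[OF that] by simp
  qed
  \<comment> \<open>Only facilities next to \<open>v\<close> serve it, and each serves at most its
    opening.\<close>
  have y_nb: "1 \<le> sum y (nb v)" if "v \<in> ?V" for v
  proof -
    have "(\<Sum>u | u \<in> F \<and> (u, v) \<in> ?E. x u v) \<le> (\<Sum>u | u \<in> F \<and> (u, v) \<in> ?E. y u)"
      using xy that by (intro sum_mono) (auto simp: F_def)
    also have "\<dots> \<le> sum y (nb v)"
    proof (rule sum_mono2)
      show "finite (nb v)" using finF by (simp add: nb_def)
      show "{u. u \<in> F \<and> (u, v) \<in> ?E} \<subseteq> nb v" using nearby_1 by (auto simp: nb_def)
      show "0 \<le> y u" if "u \<in> nb v - {u. u \<in> F \<and> (u, v) \<in> ?E}" for u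
        using that y(1) nb_subset by blast
    qed
    finally show ?thesis using serveF[OF that] by simp
  qed
  have "\<exists>S\<subseteq>F. real (card S) < sum y F + 1 \<and>
    transfer (\<lambda>u. if u \<in> F then y u else 0) (\<lambda>s. of_bool (s \<in> S))"
    by (rule integral_transfer[OF _ _ y_nb cg(2,5)]) (use y in \<open>auto simp: F_def\<close>)
  then obtain S where S: "S \<subseteq> F" "real (card S) < sum y F + 1"
    and tr: "transfer (\<lambda>u. if u \<in> F then y u else 0) (\<lambda>s. of_bool (s \<in> S))"
    by blast
  have finS: "finite S" using S finF finite_subset by blast
  obtain L where "\<forall>u\<in>V. cap u = 0 \<or> cap u = L"
    using inst unfolding zero_L_instance_def by blast
  then have L: "cap u = L" if "u \<in> F" for u
    using that cg(3) by (fastforce simp: F_def)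
  \<comment> \<open>The demand of \<open>W\<close> is charged to the facilities \<open>U\<close>
    next to it, where opening \<open>y u\<close> supports at most \<open>L * y u\<close> of it. The
    transfer finds enough of \<open>S\<close> within 5 of \<open>U\<close>, hence within 6 of
    \<open>W\<close>.\<close>
  have hall_cond: "card W \<le> L * card (\<Union>w\<in>W. {s \<in> S. nearby 6 w s})" if W: "W \<subseteq> ?V" for W
  proof -
    have finW: "finite W" using W finite_V finite_subset by blast
    define U where "U = {u \<in> F. \<exists>w\<in>W. (u, w) \<in> ?E}"
    have "real (card W) = (\<Sum>w\<in>W. \<Sum>u | u \<in> F \<and> (u, w) \<in> ?E. x u w)"
      using serveF W by (simp add: subset_iff)
    also have "\<dots> = (\<Sum>u\<in>F. \<Sum>w | w \<in> W \<and> (u, w) \<in> ?E. x u w)"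
      using finW finF by (rule sum.swap_restrict)
    also have "\<dots> = (\<Sum>u\<in>U. \<Sum>w | w \<in> W \<and> (u, w) \<in> ?E. x u w)"
      using finF by (intro sum.mono_neutral_right) (auto simp: U_def intro!: sum.neutral)
    also have "\<dots> \<le> (\<Sum>u\<in>U. L * y u)"
    proof (rule sum_mono)
      fix u assume "u \<in> U"
      then have u: "u \<in> F" "u \<in> ?V" using F_subset by (auto simp: U_def)
      have "(\<Sum>w | w \<in> W \<and> (u, w) \<in> ?E. x u w) \<le> (\<Sum>w | w \<in> ?V \<and> (u, w) \<in> ?E. x u w)"
        using W finite_V x u by (intro sum_mono2) auto
      then show "(\<Sum>w | w \<in> W \<and> (u, w) \<in> ?E. x u w) \<le> L * y u"
        using load[OF u(2)] L[OF u(1)] by simp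
    qed
    also have "\<dots> = L * (\<Sum>u\<in>U. if u \<in> F then y u else 0)"
      by (simp add: sum_distrib_left U_def)
    also have "\<dots> \<le> real L * (\<Sum>s\<in>{s \<in> ?V. \<exists>u\<in>U. nearby 5 u s}. of_bool (s \<in> S))"
    proof (rule mult_left_mono)
      have "U \<subseteq> ?V" using F_subset by (auto simp: U_def)
      then show "(\<Sum>u\<in>U. if u \<in> F then y u else 0) \<le> (\<Sum>s\<in>{s \<in> ?V. \<exists>u\<in>U. nearby 5 u s}. of_bool (s \<in> S))"
        using tr unfolding transfer_def by blast
    qed simp
    also have "(\<Sum>s\<in>{s \<in> ?V. \<exists>u\<in>U. nearby 5 u s}. of_bool (s \<in> S)) = real (card {s \<in> S. \<exists>u\<in>U. nearby 5 u s})"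
    proof -
      have "(\<Sum>s\<in>{s \<in> ?V. \<exists>u\<in>U. nearby 5 u s}. of_bool (s \<in> S) :: real) = (\<Sum>s\<in>{s \<in> S. \<exists>u\<in>U. nearby 5 u s}. 1)"
        using finite_V S F_subset by (intro sum.mono_neutral_cong_right) auto
      then show ?thesis by simp
    qed
    also have "real L * \<dots> \<le> real L * real (card (\<Union>w\<in>W. {s \<in> S. nearby 6 w s}))"
    proof -
      have "{s \<in> S. \<exists>u\<in>U. nearby 5 u s} \<subseteq> (\<Union>w\<in>W. {s \<in> S. nearby 6 w s})"
      proof
        fix s assume "s \<in> {s \<in> S. \<exists>u\<in>U. nearby 5 u s}"
        then obtain u w where *: "s \<in> S" "nearby 5 u s" "w \<in> W" "(u, w) \<in> ?E" by (auto simp: U_def)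
        then have "nearby 1 w u" using nearby_1 nearby_sym by blast
        then have "nearby 6 w s" using *(2) by (rule nearby_le) simp
        with * show "s \<in> (\<Union>w\<in>W. {s \<in> S. nearby 6 w s})" by blast
      qed
      then have "card {s \<in> S. \<exists>u\<in>U. nearby 5 u s} \<le> card (\<Union>w\<in>W. {s \<in> S. nearby 6 w s})"
        using finS finW by (intro card_mono) auto
      then show ?thesis by (intro mult_left_mono) auto
    qed
    finally show ?thesis by (simp only: of_nat_mult[symmetric] of_nat_le_iff)
  qed
  obtain \<phi> where \<phi>: "\<And>w. w \<in> ?V \<Longrightarrow> \<phi> w \<in> {s \<in> S. nearby 6 w s}"
    and \<phi>_load: "\<And>s. card {w \<in> ?V. \<phi> w = s} \<le> L"
    using hall_capacitated[OF finite_V _ hall_cond] finS by auto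
  \<comment> \<open>Part of the opening \<open>k\<close> may sit on vertices of capacity 0. The
    strict bound on \<open>card S\<close> still yields at most \<open>k\<close>.\<close>
  have "sum y F \<le> of_int k"
    unfolding total[symmetric] using finite_V F_subset y by (intro sum_mono2) auto
  then have "int (card S) \<le> k" using S(2) by linarith
  have "of_int k \<le> real (card ?V)"
    unfolding total[symmetric] using sum_bounded_above[of ?V y 1] y(2) by simp
  then have "k \<le> int (card ?V)" by linarith
  then obtain S' where S': "S \<subseteq> S'" "S' \<subseteq> ?V" "card S' = nat k"
  proof -
    have "card S \<le> nat k" "nat k \<le> card ?V" "S \<subseteq> ?V"
      using \<open>int (card S) \<le> k\<close> \<open>k \<le> int (card ?V)\<close> S(1) F_subset by auto
    from exists_subset_between[OF this finite_V] show ?thesis using that by blast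
  qed
  have "is_solution 6 k cap H S' \<phi>"
    unfolding is_solution_def
  proof (intro conjI ballI)
    show "S' \<subseteq> ?V" by fact
    show "int (card S') = k" using S'(3) \<open>int (card S) \<le> k\<close> by simp
    show "\<phi> u \<in> S'" if "u \<in> ?V" for u using \<phi>[OF that] S' by blast
    show "graph_dist H u (\<phi> u) \<le> ereal (real 6)" if "u \<in> ?V" for u
    proof -
      have "\<phi> u \<in> ?V" "nearby 6 u (\<phi> u)" using \<phi>[OF that] S F_subset by auto
      then show ?thesis
        unfolding nearby_def using graph_dist_le_iff[OF cg(1)] by blast
    qed
    show "card {u \<in> ?V. \<phi> u = v} \<le> cap v" if "v \<in> S'" for v
    proof (cases "v \<in> S")
      case True
      then show ?thesis using \<phi>_load[of v] L[of v] S by auto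
    next
      case False
      \<comment> \<open>Such a \<open>v\<close> was added only to reach \<open>k\<close>; it may
        have capacity 0, but it serves nobody.\<close>
      then have "{u \<in> ?V. \<phi> u = v} = {}" using \<phi> by auto
      then show ?thesis by (simp only: card.empty)
    qed
  qed
  then show ?thesis by blast
qed

section \<open>Computability of the search\<close>

definition rec_fn :: "nat \<Rightarrow> (nat list \<Rightarrow> nat) \<Rightarrow> bool" where
  "rec_fn n f \<longleftrightarrow> (\<exists>p. \<forall>xs. length xs = n \<longrightarrow> computes p xs (f xs))"

definition rec_rel :: "nat \<Rightarrow> (nat list \<Rightarrow> bool) \<Rightarrow> bool" where
  "rec_rel n P \<longleftrightarrow> rec_fn n (\<lambda>xs. of_bool (P xs))"

lemma rec_fn_cong:
  assumes "rec_fn n f" "\<And>xs. length xs = n \<Longrightarrow> f xs = g xs"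
  shows "rec_fn n g"
  using assms unfolding rec_fn_def by metis

lemma rec_nth: "i < n \<Longrightarrow> rec_fn n (\<lambda>xs. xs ! i)"
  unfolding rec_fn_def by (auto intro!: exI[of _ "Proj i"] computes.Proj)

lemma rec_comp:
  assumes "rec_fn (length fs) g" "\<And>f. f \<in> set fs \<Longrightarrow> rec_fn n f"
  shows "rec_fn n (\<lambda>xs. g (map (\<lambda>f. f xs) fs))"
proof -
  obtain p where p: "\<And>ys. length ys = length fs \<Longrightarrow> computes p ys (g ys)"
    using assms(1) unfolding rec_fn_def by blast
  have "\<forall>f\<in>set fs. \<exists>q. \<forall>xs. length xs = n \<longrightarrow> computes q xs (f xs)"
    using assms(2) unfolding rec_fn_def by blast
  then obtain q where q: "\<And>f xs. f \<in> set fs \<Longrightarrow> length xs = n \<Longrightarrow> computes (q f) xs (f xs)"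
    by metis
  have "computes (Comp p (map q fs)) xs (g (map (\<lambda>f. f xs) fs))" if "length xs = n" for xs
    using p q that by (intro computes.Comp[where ys = "map (\<lambda>f. f xs) fs"]) auto
  then show ?thesis unfolding rec_fn_def by blast
qed

lemma rec_Suc:
  assumes "rec_fn n f"
  shows "rec_fn n (\<lambda>xs. Suc (f xs))"
proof -
  have "rec_fn 1 (\<lambda>xs. Suc (xs ! 0))"
    unfolding rec_fn_def by (auto simp: length_Suc_conv intro!: exI[of _ recf.Succ] computes.Succ)
  then show ?thesis
    using rec_comp[of "[f]" "\<lambda>xs. Suc (xs ! 0)" n] assms by simp
qed

lemma rec_const: "rec_fn n (\<lambda>_. c)"
proof (induction c)
  case 0
  show ?case unfolding rec_fn_def by (blast intro: computes.Zero)
next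
  case (Suc c)
  then show ?case by (rule rec_Suc)
qed

lemma rec_select:
  assumes "rec_fn m f" "length is = m" "\<And>i. i \<in> set is \<Longrightarrow> i < n"
  shows "rec_fn n (\<lambda>xs. f (map ((!) xs) is))"
  using rec_comp[of "map (\<lambda>i xs. xs ! i) is" f n] assms rec_nth by (auto simp: comp_def)

text \<open>Weakening: a bounded quantifier or sum puts its variable at the head of the argument
  list, and outer terms then refer to the tail.\<close>

lemma rec_tl:
  assumes "rec_fn n f"
  shows "rec_fn (Suc n) (\<lambda>ys. f (tl ys))"
proof -
  have "map ((!) ys) [1..<Suc n] = tl ys" if "length ys = Suc n" for ys :: "nat list"
    using that by (intro nth_equalityI) (auto simp: nth_tl simp del: upt_Suc)
  then show ?thesis
    using rec_select[OF assms, of "[1..<Suc n]" "Suc n"] by (auto intro: rec_fn_cong simp del: upt_Suc)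
qed

lemma rec_rec_nat:
  assumes "rec_fn n b" "rec_fn n f" "rec_fn (Suc (Suc n)) (\<lambda>ys. g (ys ! 0) (ys ! 1) (tl (tl ys)))"
  shows "rec_fn n (\<lambda>xs. rec_nat (f xs) (\<lambda>i r. g i r xs) (b xs))"
proof -
  obtain p q where p: "\<And>xs. length xs = n \<Longrightarrow> computes p xs (f xs)"
    and q: "\<And>ys. length ys = Suc (Suc n) \<Longrightarrow> computes q ys (g (ys ! 0) (ys ! 1) (tl (tl ys)))"
    using assms(2,3) unfolding rec_fn_def by blast
  have "computes (PrimRec p q) (m # xs) (rec_nat (f xs) (\<lambda>i r. g i r xs) m)" if "length xs = n" for m xs
  proof (induction m)
    case 0
    then show ?case using p that by (simp add: computes.PrimRec_0)
  next
    case (Suc m)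
    show ?case
      using computes.PrimRec_Suc[OF Suc.IH] q[of "m # _ # xs"] that by simp
  qed
  then have "rec_fn (Suc n) (\<lambda>ys. rec_nat (f (tl ys)) (\<lambda>i r. g i r (tl ys)) (hd ys))"
    unfolding rec_fn_def by (intro exI[of _ "PrimRec p q"]) (auto simp: length_Suc_conv)
  \<comment> \<open>\<open>PrimRec\<close> recurses on its first argument, so the value of
    \<open>b\<close> is computed and put in front of a copy of the arguments.\<close>
  then have "rec_fn n (\<lambda>xs. (\<lambda>ys. rec_nat (f (tl ys)) (\<lambda>i r. g i r (tl ys)) (hd ys))
      (map (\<lambda>f. f xs) (b # map (\<lambda>i xs. xs ! i) [0..<n])))"
    using assms(1) by (intro rec_comp) (auto intro: rec_nth)
  then show ?thesis
  proof (rule rec_fn_cong)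
    fix xs :: "nat list" assume "length xs = n"
    then have "map (\<lambda>i. xs ! i) [0..<n] = xs" using map_nth by blast
    then show "(\<lambda>ys. rec_nat (f (tl ys)) (\<lambda>i r. g i r (tl ys)) (hd ys))
        (map (\<lambda>f. f xs) (b # map (\<lambda>i xs. xs ! i) [0..<n])) = rec_nat (f xs) (\<lambda>i r. g i r xs) (b xs)"
      by (simp add: comp_def)
  qed
qed

lemma rec_add:
  assumes "rec_fn n f" "rec_fn n g"
  shows "rec_fn n (\<lambda>xs. f xs + g xs)"
proof -
  have "rec_nat a (\<lambda>i r. Suc r) b = a + b" for a b by (induction b) auto
  then show ?thesis
    using rec_rec_nat[OF assms(2,1), of "\<lambda>i r xs. Suc r"] rec_Suc rec_nth[of 1 "Suc (Suc n)"] by simp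
qed

lemma rec_diff:
  assumes "rec_fn n f" "rec_fn n g"
  shows "rec_fn n (\<lambda>xs. f xs - g xs)"
proof -
  have pred: "rec_nat 0 (\<lambda>i r. i) a = a - 1" for a by (cases a) auto
  have "rec_nat a (\<lambda>i r. r - 1) b = a - b" for a b by (induction b) auto
  moreover have "rec_fn m (\<lambda>xs. h xs - 1)" if "rec_fn m h" for m h
    using rec_rec_nat[OF that rec_const[of m 0], of "\<lambda>i r xs. i"] rec_nth[of 0 "Suc (Suc m)"]
    by (simp add: pred)
  then have "rec_fn (Suc (Suc n)) (\<lambda>ys. ys ! 1 - 1)" using rec_nth by simp
  ultimately show ?thesis
    using rec_rec_nat[OF assms(2,1), of "\<lambda>i r xs. r - 1"] by simp
qed

lemma rec_mult:
  assumes "rec_fn n f" "rec_fn n g"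
  shows "rec_fn n (\<lambda>xs. f xs * g xs)"
proof -
  have "rec_nat 0 (\<lambda>i r. r + a) b = a * b" for a b :: nat by (induction b) auto
  moreover have "rec_fn (Suc (Suc n)) (\<lambda>ys. ys ! 1 + f (tl (tl ys)))"
    using assms by (intro rec_add rec_nth rec_tl) simp
  ultimately show ?thesis
    using rec_rec_nat[OF assms(2) rec_const[of n 0], of "\<lambda>i r xs. r + f xs"] by simp
qed

lemma rec_power2:
  assumes "rec_fn n f"
  shows "rec_fn n (\<lambda>xs. 2 ^ f xs)"
proof -
  have "rec_nat 1 (\<lambda>i r. r + r) b = (2 :: nat) ^ b" for b by (induction b) auto
  moreover have "rec_fn (Suc (Suc n)) (\<lambda>ys. ys ! 1 + ys ! 1)"
    by (intro rec_add rec_nth) simp_all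
  ultimately show ?thesis
    using rec_rec_nat[OF assms rec_const[of n 1], of "\<lambda>i r xs. r + r"] by simp
qed

lemma rec_prod_encode:
  assumes "rec_fn n f" "rec_fn n g"
  shows "rec_fn n (\<lambda>xs. prod_encode (f xs, g xs))"
proof -
  have "rec_nat 0 (\<lambda>i r. r + Suc i) b = triangle b" for b by (induction b) auto
  moreover have "rec_fn (Suc (Suc n)) (\<lambda>ys. ys ! 1 + Suc (ys ! 0))"
    by (intro rec_add rec_Suc rec_nth) simp_all
  ultimately have "rec_fn n (\<lambda>xs. triangle (f xs + g xs))"
    using rec_rec_nat[OF rec_add[OF assms] rec_const[of n 0], of "\<lambda>i r xs. r + Suc i"] by simp
  then show ?thesis
    unfolding prod_encode_def prod.case using assms(1) by (rule rec_add)
qed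

lemma rec_sum:
  assumes "rec_fn n b" "rec_fn (Suc n) (\<lambda>ys. f (ys ! 0) (tl ys))"
  shows "rec_fn n (\<lambda>xs. \<Sum>i<b xs. f i xs)"
proof -
  have "rec_nat 0 (\<lambda>i r. r + h i) m = (\<Sum>i<m. h i)" for h :: "nat \<Rightarrow> nat" and m
    by (induction m) auto
  moreover have "rec_fn (Suc (Suc n)) (\<lambda>ys. f (ys ! 0) (tl (tl ys)))"
  proof -
    have sel: "map ((!) ys) [2..<Suc (Suc n)] = tl (tl ys)"
      if "length ys = Suc (Suc n)" for ys :: "nat list"
      using that by (auto simp: length_Suc_conv intro!: nth_equalityI simp del: upt_Suc)
    have "rec_fn (Suc (Suc n)) (\<lambda>ys. (\<lambda>zs. f (zs ! 0) (tl zs)) (map ((!) ys) (0 # [2..<Suc (Suc n)])))"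
      by (rule rec_select[OF assms(2)]) auto
    then show ?thesis
      by (rule rec_fn_cong) (simp add: sel del: upt_Suc)
  qed
  then have "rec_fn (Suc (Suc n)) (\<lambda>ys. ys ! 1 + f (ys ! 0) (tl (tl ys)))"
    by (intro rec_add rec_nth) simp
  ultimately show ?thesis
    using rec_rec_nat[OF assms(1) rec_const[of n 0], of "\<lambda>i r xs. r + f i xs"] by simp
qed

lemma rec_le:
  assumes "rec_fn n f" "rec_fn n g"
  shows "rec_rel n (\<lambda>xs. f xs \<le> g xs)"
  \<comment> \<open>With truncated subtraction, the truth value is
    \<open>1 - (f xs - g xs)\<close>.\<close>
  unfolding rec_rel_def
  by (rule rec_fn_cong[OF rec_diff[OF rec_const[of n 1] rec_diff[OF assms]]]) auto

lemma rec_conj: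
  assumes "rec_rel n P" "rec_rel n Q"
  shows "rec_rel n (\<lambda>xs. P xs \<and> Q xs)"
  using rec_mult[OF assms[unfolded rec_rel_def]] unfolding rec_rel_def by (simp add: of_bool_conj)

lemma rec_not:
  assumes "rec_rel n P"
  shows "rec_rel n (\<lambda>xs. \<not> P xs)"
  using rec_diff[OF rec_const[of n 1] assms[unfolded rec_rel_def]]
  unfolding rec_rel_def by (rule rec_fn_cong) auto

lemma rec_disj:
  assumes "rec_rel n P" "rec_rel n Q"
  shows "rec_rel n (\<lambda>xs. P xs \<or> Q xs)"
  using rec_not[OF rec_conj[OF assms[THEN rec_not]]] by simp

lemma rec_imp:
  assumes "rec_rel n P" "rec_rel n Q"
  shows "rec_rel n (\<lambda>xs. P xs \<longrightarrow> Q xs)"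
  using rec_disj[OF rec_not[OF assms(1)] assms(2)] by (simp only: imp_conv_disj)

lemma rec_eq:
  assumes "rec_fn n f" "rec_fn n g"
  shows "rec_rel n (\<lambda>xs. f xs = g xs)"
  using rec_conj[OF rec_le[OF assms] rec_le[OF assms(2,1)]] by (simp only: order_eq_iff[symmetric])

lemma rec_card:
  assumes "rec_fn n b" "rec_rel (Suc n) (\<lambda>ys. P (ys ! 0) (tl ys))"
  shows "rec_fn n (\<lambda>xs. card {i. i < b xs \<and> P i xs})"
proof -
  have "(\<Sum>i<m. of_bool (Q i)) = card {i. i < m \<and> Q i}" for m :: nat and Q
    by (simp add: lessThan_def Collect_conj_eq[symmetric])
  then show ?thesis
    using rec_sum[OF assms(1), of "\<lambda>i xs. of_bool (P i xs)"] assms(2) by (simp add: rec_rel_def)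
qed

lemma rec_ex:
  assumes "rec_fn n b" "rec_rel (Suc n) (\<lambda>ys. P (ys ! 0) (tl ys))"
  shows "rec_rel n (\<lambda>xs. \<exists>i<b xs. P i xs)"
proof -
  have "1 \<le> card {i. i < m \<and> Q i} \<longleftrightarrow> (\<exists>i<m. Q i)" for m :: nat and Q
    by (auto simp: Suc_le_eq card_gt_0_iff)
  then show ?thesis
    using rec_le[OF rec_const[of n 1] rec_card[OF assms]] by simp
qed

lemma rec_all:
  assumes "rec_fn n b" "rec_rel (Suc n) (\<lambda>ys. P (ys ! 0) (tl ys))"
  shows "rec_rel n (\<lambda>xs. \<forall>i<b xs. P i xs)"
  using rec_not[OF rec_ex[OF assms(1) rec_not[OF assms(2)]]] by simp

lemma rec_mem:
  assumes "rec_fn n f" "rec_fn n g"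
  shows "rec_rel n (\<lambda>xs. f xs \<in> set_decode (g xs))"
proof -
  \<comment> \<open>Bit \<open>x\<close> of \<open>e\<close> is set iff \<open>e\<close> splits as
    an odd multiple of \<open>2 ^ x\<close> plus a smaller rest. This replaces division and parity
    by bounded quantifiers.\<close>
  have "x \<in> set_decode e \<longleftrightarrow> (\<exists>q<Suc e. \<exists>r<2 ^ x. e = (q + q + 1) * 2 ^ x + r)" for x e
  proof
    assume "x \<in> set_decode e"
    then have "odd (e div 2 ^ x)" by (simp add: set_decode_def)
    then obtain q where q: "e div 2 ^ x = 2 * q + 1" by (rule oddE)
    then have "q \<le> e div 2 ^ x" by linarith
    also have "\<dots> \<le> e" by simp
    finally have "q < Suc e" by simp
    moreover have "e = (q + q + 1) * 2 ^ x + e mod 2 ^ x"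
      using div_mult_mod_eq[of e "2 ^ x"] unfolding q by (simp add: mult_2)
    moreover have "e mod 2 ^ x < 2 ^ x" by simp
    ultimately show "\<exists>q<Suc e. \<exists>r<2 ^ x. e = (q + q + 1) * 2 ^ x + r" by blast
  next
    assume "\<exists>q<Suc e. \<exists>r<2 ^ x. e = (q + q + 1) * 2 ^ x + r"
    then obtain q r where "r < 2 ^ x" "e = (q + q + 1) * 2 ^ x + r" by blast
    then have "e div 2 ^ x = q + q + 1"
      using div_mult_self3[of "2 ^ x" "q + q + 1" r] by (simp only: div_less)
    then show "x \<in> set_decode e" by (simp add: set_decode_def)
  qed
  moreover have "rec_rel n (\<lambda>xs. \<exists>q<Suc (g xs). \<exists>r<2 ^ f xs. g xs = (q + q + 1) * 2 ^ f xs + r)"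
    by (intro rec_ex rec_eq rec_Suc rec_power2 rec_add rec_mult rec_const rec_nth rec_tl assms) simp_all
  ultimately show ?thesis by simp
qed

lemma rec_mu:
  assumes "rec_rel (Suc n) P"
  shows "\<exists>p. \<forall>xs. length xs = n \<longrightarrow> (\<exists>m. P (m # xs)) \<longrightarrow> computes p xs (LEAST m. P (m # xs))"
proof -
  \<comment> \<open>\<open>Mu\<close> searches for the value 0, so the negation is what has to be
    computed.\<close>
  obtain p where p: "\<And>ys. length ys = Suc n \<Longrightarrow> computes p ys (of_bool (\<not> P ys))"
    using rec_not[OF assms] unfolding rec_rel_def rec_fn_def by blast
  have "computes (Mu p) xs (LEAST m. P (m # xs))" if "length xs = n" "\<exists>m. P (m # xs)" for xs
  proof (rule computes.Mu)
    show "computes p ((LEAST m. P (m # xs)) # xs) 0"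
      using p[of "(LEAST m. P (m # xs)) # xs"] LeastI_ex[OF that(2)] that(1) by simp
    show "\<forall>i<LEAST m. P (m # xs). \<exists>v. computes p (i # xs) (Suc v)"
    proof (intro allI impI)
      fix i assume "i < (LEAST m. P (m # xs))"
      then have "\<not> P (i # xs)" by (rule not_less_Least)
      then show "\<exists>v. computes p (i # xs) (Suc v)"
        using p[of "i # xs"] that(1) by (intro exI[of _ 0]) simp
    qed
  qed
  then show ?thesis by blast
qed

section \<open>Coded relations and the arithmetical test for a solution\<close>

definition pairs :: "nat \<Rightarrow> (nat \<times> nat) set" where
  "pairs e = {p. prod_encode p \<in> set_decode e}"

lemma rec_pairs:
  assumes "rec_fn n f" "rec_fn n g" "rec_fn n e"
  shows "rec_rel n (\<lambda>xs. (f xs, g xs) \<in> pairs (e xs))"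
  unfolding pairs_def mem_Collect_eq using assms by (intro rec_mem rec_prod_encode)

text \<open>A set bit \<open>x\<close> gives \<open>2 ^ x \<le> e\<close>. This is what makes
  quantifiers bounded by a code exhaustive.\<close>

lemma set_decode_less: "x \<in> set_decode e \<Longrightarrow> x < e"
proof -
  assume "x \<in> set_decode e"
  then have "odd (e div 2 ^ x)" by (simp add: set_decode_def)
  then have "e div 2 ^ x \<noteq> 0" using odd_pos by auto
  then have "2 ^ x \<le> e" by (metis div_less not_le)
  then show "x < e" using less_exp[of x] by linarith
qed

lemma pairs_less: "(u, v) \<in> pairs e \<Longrightarrow> u < e" "(u, v) \<in> pairs e \<Longrightarrow> v < e"
  using set_decode_less[of "prod_encode (u, v)" e] le_prod_encode_1[of u v] le_prod_encode_2[of v u]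
  by (auto simp: pairs_def)

definition step :: "nat \<Rightarrow> nat \<Rightarrow> nat \<Rightarrow> bool" where
  "step E u v \<longleftrightarrow> u = v \<or> (u, v) \<in> pairs E"

text \<open>The five inner vertices of a walk are written out so that bounded quantifiers suffice;
  as \<open>step\<close> may stand still, shorter walks are included.\<close>

definition six_steps :: "nat \<Rightarrow> nat \<Rightarrow> nat \<Rightarrow> nat \<Rightarrow> bool" where
  "six_steps b E u v \<longleftrightarrow> (\<exists>p<b. \<exists>q<b. \<exists>r<b. \<exists>s<b. \<exists>t<b.
     step E u p \<and> step E p q \<and> step E q r \<and> step E r s \<and> step E s t \<and> step E t v)"

lemma rec_step:
  assumes "rec_fn n e" "rec_fn n f" "rec_fn n g"
  shows "rec_rel n (\<lambda>xs. step (e xs) (f xs) (g xs))"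
  unfolding step_def using assms by (intro rec_disj rec_eq rec_pairs)

lemma rec_six_steps:
  assumes "rec_fn n b" "rec_fn n e" "rec_fn n f" "rec_fn n g"
  shows "rec_rel n (\<lambda>xs. six_steps (b xs) (e xs) (f xs) (g xs))"
  unfolding six_steps_def
  by (intro rec_ex rec_conj rec_step rec_nth rec_tl assms) simp_all

lemma six_steps_iff:
  assumes "u < b" "E < b"
  shows "six_steps b E u v \<longleftrightarrow> (u, v) \<in> (pairs E \<union> Id) ^^ 6"
proof -
  have relpow6: "(u, v) \<in> R ^^ 6 \<longleftrightarrow> (\<exists>p q r s t. (u, p) \<in> R \<and> (p, q) \<in> R \<and> (q, r) \<in> R \<and>
    (r, s) \<in> R \<and> (s, t) \<in> R \<and> (t, v) \<in> R)" for R :: "(nat \<times> nat) set"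
  proof -
    have "R ^^ 6 = R O R O R O R O R O R"
      by (simp add: numeral_eq_Suc O_assoc)
    then show ?thesis by (simp add: relcomp_unfold)
  qed
  have step_iff: "step E x z \<longleftrightarrow> (x, z) \<in> pairs E \<union> Id" for x z
    by (auto simp: step_def)
  have bound: "z < b" if "step E x z" "x < b" for x z
    using that pairs_less(2)[of x z E] assms(2) by (auto simp: step_def)
  have "(u, v) \<in> (pairs E \<union> Id) ^^ 6 \<longleftrightarrow>
    (\<exists>p q r s t. step E u p \<and> step E p q \<and> step E q r \<and> step E r s \<and> step E s t \<and> step E t v)"
    unfolding step_iff by (rule relpow6)
  also have "\<dots> \<longleftrightarrow> six_steps b E u v"
  proof
    assume "\<exists>p q r s t. step E u p \<and> step E p q \<and> step E q r \<and> step E r s \<and> step E s t \<and> step E t v"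
    then obtain p q r s t where *: "step E u p" "step E p q" "step E q r" "step E r s" "step E s t" "step E t v"
      by blast
    then have "p < b" "q < b" "r < b" "s < b" "t < b"
      using bound assms(1) by blast+
    with * show "six_steps b E u v" unfolding six_steps_def by blast
  qed (unfold six_steps_def, blast)
  finally show ?thesis by simp
qed

text \<open>One bound \<open>b\<close> above all codes serves every quantifier. The assignment is
  represented by its graph, coded by \<open>f\<close>.\<close>

definition valid :: "nat \<Rightarrow> nat \<Rightarrow> nat \<Rightarrow> nat \<Rightarrow> nat \<Rightarrow> bool" where
  "valid z k V E C \<longleftrightarrow> (let b = Suc (z + V + E + C) in \<exists>s<b. \<exists>f<b. z = prod_encode (s, f) \<and>
     (\<forall>x<b. x \<in> set_decode s \<longrightarrow> x \<in> set_decode V) \<and>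
     card {x. x < b \<and> x \<in> set_decode s} = k \<and>
     (\<forall>u<b. \<forall>v<b. (u, v) \<in> pairs f \<longrightarrow> u \<in> set_decode V \<and> v \<in> set_decode s \<and> six_steps b E u v) \<and>
     (\<forall>u<b. u \<in> set_decode V \<longrightarrow> (\<exists>v<b. (u, v) \<in> pairs f)) \<and>
     (\<forall>u<b. \<forall>v<b. \<forall>w<b. (u, v) \<in> pairs f \<and> (u, w) \<in> pairs f \<longrightarrow> v = w) \<and>
     (\<forall>v<b. v \<in> set_decode s \<longrightarrow>
       (\<exists>c<b. (v, c) \<in> pairs C \<and> card {u. u < b \<and> (u, v) \<in> pairs f} \<le> c)))"

lemma rec_valid: "rec_rel 5 (\<lambda>xs. valid (xs ! 0) (xs ! 1) (xs ! 2) (xs ! 3) (xs ! 4))"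
  unfolding valid_def Let_def
  by (intro rec_ex rec_all rec_conj rec_imp rec_eq rec_le rec_card rec_mem rec_pairs rec_six_steps
      rec_Suc rec_add rec_prod_encode rec_nth rec_tl) simp_all

text \<open>The meaning of \<open>valid\<close> freed from codes and bounds: an intermediate form
  between numbers and labelled graphs.\<close>

definition solves ::
  "nat \<Rightarrow> nat set \<Rightarrow> (nat \<times> nat) set \<Rightarrow> (nat \<times> nat) set \<Rightarrow> nat set \<Rightarrow> (nat \<times> nat) set \<Rightarrow> bool" where
  "solves k V E C S R \<longleftrightarrow> S \<subseteq> V \<and> card S = k \<and>
     (\<forall>u v. (u, v) \<in> R \<longrightarrow> u \<in> V \<and> v \<in> S \<and> (u, v) \<in> (E \<union> Id) ^^ 6) \<and>
     (\<forall>u\<in>V. \<exists>v. (u, v) \<in> R) \<and>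
     (\<forall>u v w. (u, v) \<in> R \<and> (u, w) \<in> R \<longrightarrow> v = w) \<and>
     (\<forall>v\<in>S. \<exists>c. (v, c) \<in> C \<and> card {u. (u, v) \<in> R} \<le> c)"

lemma valid_iff:
  "valid z k V E C \<longleftrightarrow> (\<exists>s f. z = prod_encode (s, f) \<and>
     solves k (set_decode V) (pairs E) (pairs C) (set_decode s) (pairs f))"
proof -
  define b where "b = Suc (z + V + E + C)"
  have bounds: "V < b" "E < b" "C < b" "z < b" by (auto simp: b_def)
  have body: "(\<forall>x<b. x \<in> set_decode s \<longrightarrow> x \<in> set_decode V) \<and>
     card {x. x < b \<and> x \<in> set_decode s} = k \<and>
     (\<forall>u<b. \<forall>v<b. (u, v) \<in> pairs f \<longrightarrow> u \<in> set_decode V \<and> v \<in> set_decode s \<and> six_steps b E u v) \<and>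
     (\<forall>u<b. u \<in> set_decode V \<longrightarrow> (\<exists>v<b. (u, v) \<in> pairs f)) \<and>
     (\<forall>u<b. \<forall>v<b. \<forall>w<b. (u, v) \<in> pairs f \<and> (u, w) \<in> pairs f \<longrightarrow> v = w) \<and>
     (\<forall>v<b. v \<in> set_decode s \<longrightarrow>
       (\<exists>c<b. (v, c) \<in> pairs C \<and> card {u. u < b \<and> (u, v) \<in> pairs f} \<le> c)) \<longleftrightarrow>
     solves k (set_decode V) (pairs E) (pairs C) (set_decode s) (pairs f)"
    if "s < b" "f < b" for s f
  proof -
    have s: "x < b" if "x \<in> set_decode s" for x
      using set_decode_less[OF that] \<open>s < b\<close> by simp
    have V: "x < b" if "x \<in> set_decode V" for x
      using set_decode_less[OF that] bounds by simp
    have f: "x < b" "y < b" if "(x, y) \<in> pairs f" for x y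
      using pairs_less[OF that] \<open>f < b\<close> by simp_all
    have C: "x < b" "y < b" if "(x, y) \<in> pairs C" for x y
      using pairs_less[OF that] bounds by simp_all
    have sets: "{x. x < b \<and> x \<in> set_decode s} = set_decode s"
      "{u. u < b \<and> (u, v) \<in> pairs f} = {u. (u, v) \<in> pairs f}" for v
      using s f(1) by auto
    have parts: "(\<forall>x<b. x \<in> set_decode s \<longrightarrow> x \<in> set_decode V) \<longleftrightarrow> set_decode s \<subseteq> set_decode V"
      "(\<forall>u<b. \<forall>v<b. (u, v) \<in> pairs f \<longrightarrow> u \<in> set_decode V \<and> v \<in> set_decode s \<and> six_steps b E u v) \<longleftrightarrow>
       (\<forall>u v. (u, v) \<in> pairs f \<longrightarrow> u \<in> set_decode V \<and> v \<in> set_decode s \<and> (u, v) \<in> (pairs E \<union> Id) ^^ 6)"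
      "(\<forall>u<b. u \<in> set_decode V \<longrightarrow> (\<exists>v<b. (u, v) \<in> pairs f)) \<longleftrightarrow>
       (\<forall>u\<in>set_decode V. \<exists>v. (u, v) \<in> pairs f)"
      "(\<forall>u<b. \<forall>v<b. \<forall>w<b. (u, v) \<in> pairs f \<and> (u, w) \<in> pairs f \<longrightarrow> v = w) \<longleftrightarrow>
       (\<forall>u v w. (u, v) \<in> pairs f \<and> (u, w) \<in> pairs f \<longrightarrow> v = w)"
      "(\<forall>v<b. v \<in> set_decode s \<longrightarrow> (\<exists>c<b. (v, c) \<in> pairs C \<and> card {u. (u, v) \<in> pairs f} \<le> c)) \<longleftrightarrow>
       (\<forall>v\<in>set_decode s. \<exists>c. (v, c) \<in> pairs C \<and> card {u. (u, v) \<in> pairs f} \<le> c)"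
          subgoal using s by blast
         subgoal
           by (simp only: six_steps_iff[OF _ bounds(2)] cong: imp_cong) (use f in blast)
        subgoal using V f by blast
       subgoal using f by blast
      subgoal using s C by blast
      done
    show ?thesis unfolding sets parts solves_def by blast
  qed
  have code_bounds: "s < b" "f < b" if "z = prod_encode (s, f)" for s f
    using that le_prod_encode_1[of s f] le_prod_encode_2[of f s] bounds by simp_all
  have "valid z k V E C \<longleftrightarrow> (\<exists>s<b. \<exists>f<b. z = prod_encode (s, f) \<and>
     solves k (set_decode V) (pairs E) (pairs C) (set_decode s) (pairs f))"
    unfolding valid_def Let_def b_def[symmetric] by (simp only: body cong: conj_cong)
  then show ?thesis using code_bounds by blast
qed

section \<open>Codes, labellings, and the correctness of the test\<close>

lemma pairs_encode:
  assumes "finite R"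
  shows "pairs (set_encode (prod_encode ` R)) = R"
  using assms by (auto simp: pairs_def dest: injD[OF inj_prod_encode])

lemma set_decode_pairs: "set_decode f = prod_encode ` pairs f"
proof -
  have "x \<in> prod_encode ` pairs f" if "x \<in> set_decode f" for x
    using that by (intro image_eqI[of _ _ "prod_decode x"]) (auto simp: pairs_def)
  then show ?thesis by (auto simp: pairs_def)
qed

lemma relpow_inj_image:
  assumes "inj_on \<nu> V" "E \<subseteq> V \<times> V" "u \<in> V" "v \<in> V"
  shows "(\<nu> u, \<nu> v) \<in> (map_prod \<nu> \<nu> ` E \<union> Id) ^^ n \<longleftrightarrow> (u, v) \<in> (E \<union> Id) ^^ n"
proof
  \<comment> \<open>\<open>\<nu>\<close> is injective only on \<open>V\<close>, so the induction
    must also show that every point reached is the label of a vertex.\<close>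
  have "\<exists>v\<in>V. b = \<nu> v \<and> (u, v) \<in> (E \<union> Id) ^^ n"
    if "(\<nu> u, b) \<in> (map_prod \<nu> \<nu> ` E \<union> Id) ^^ n" for b
    using that
  proof (induction n arbitrary: b)
    case (Suc n)
    then obtain c where c: "(\<nu> u, c) \<in> (map_prod \<nu> \<nu> ` E \<union> Id) ^^ n" "(c, b) \<in> map_prod \<nu> \<nu> ` E \<union> Id"
      by auto
    from Suc.IH[OF c(1)] obtain w where w: "w \<in> V" "c = \<nu> w" "(u, w) \<in> (E \<union> Id) ^^ n" by blast
    show ?case
    proof (cases "c = b")
      case True
      then show ?thesis using w by auto
    next
      case False
      then obtain x y where xy: "(x, y) \<in> E" "c = \<nu> x" "b = \<nu> y" using c(2) by auto
      then have "x \<in> V" "y \<in> V" using assms(2) by auto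
      then have "x = w" using inj_onD[OF assms(1)] w xy by metis
      then show ?thesis using w xy \<open>y \<in> V\<close> by auto
    qed
  qed (use assms(3) in auto)
  moreover assume "(\<nu> u, \<nu> v) \<in> (map_prod \<nu> \<nu> ` E \<union> Id) ^^ n"
  ultimately show "(u, v) \<in> (E \<union> Id) ^^ n"
    using inj_onD[OF assms(1) _ assms(4)] by blast
next
  assume "(u, v) \<in> (E \<union> Id) ^^ n"
  then show "(\<nu> u, \<nu> v) \<in> (map_prod \<nu> \<nu> ` E \<union> Id) ^^ n"
  proof (induction n arbitrary: v)
    case (Suc n)
    then obtain w where w: "(u, w) \<in> (E \<union> Id) ^^ n" "(w, v) \<in> E \<union> Id" by auto
    have "(\<nu> w, \<nu> v) \<in> map_prod \<nu> \<nu> ` E \<union> Id"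
      using w(2) by force
    with Suc.IH[OF w(1)] show ?case by (rule relpow_Suc_I)
  qed simp
qed

locale labelled_graph =
  fixes H :: "('a, 'b) pre_digraph" and cap :: "'a \<Rightarrow> nat" and \<nu> :: "'a \<Rightarrow> nat"
  assumes wf_H: "wf_digraph H" and fin: "finite (verts H)" and inj: "inj_on \<nu> (verts H)"
begin

abbreviation "V' \<equiv> \<nu> ` verts H"
abbreviation "E' \<equiv> map_prod \<nu> \<nu> ` arcs_ends H"
abbreviation "C' \<equiv> (\<lambda>u. (\<nu> u, cap u)) ` verts H"
abbreviation "R' \<phi> \<equiv> (\<lambda>u. (\<nu> u, \<nu> (\<phi> u))) ` verts H"

lemma arcs_ends_subset: "arcs_ends H \<subseteq> verts H \<times> verts H"
  using wf_H by (auto simp: arcs_ends_conv wf_digraph.tail_in_verts wf_digraph.head_in_verts)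

lemma dist_iff:
  assumes "u \<in> verts H" "v \<in> verts H"
  shows "(\<nu> u, \<nu> v) \<in> (E' \<union> Id) ^^ 6 \<longleftrightarrow> graph_dist H u v \<le> ereal (real 6)"
  unfolding graph_dist_le_iff[OF wf_H assms(2)]
  by (rule relpow_inj_image[OF inj arcs_ends_subset assms])

lemma card_fibre:
  assumes "\<And>u. u \<in> verts H \<Longrightarrow> \<phi> u \<in> verts H" "v \<in> verts H"
  shows "card {a. (a, \<nu> v) \<in> R' \<phi>} = card {u \<in> verts H. \<phi> u = v}"
proof -
  have "{a. (a, \<nu> v) \<in> R' \<phi>} = \<nu> ` {u \<in> verts H. \<phi> u = v}"
    using inj_onD[OF inj] assms by (auto simp: image_iff)
  moreover have "inj_on \<nu> {u \<in> verts H. \<phi> u = v}"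
    using inj by (rule inj_on_subset) auto
  ultimately show ?thesis by (simp add: card_image)
qed

lemma is_solution_imp_solves:
  assumes "is_solution 6 k cap H S \<phi>"
  shows "solves (nat k) V' E' C' (\<nu> ` S) (R' \<phi>)"
proof -
  have S: "S \<subseteq> verts H" "int (card S) = k"
    and \<phi>: "\<And>u. u \<in> verts H \<Longrightarrow> \<phi> u \<in> S" "\<And>u. u \<in> verts H \<Longrightarrow> graph_dist H u (\<phi> u) \<le> ereal (real 6)"
    and load: "\<And>v. v \<in> S \<Longrightarrow> card {u \<in> verts H. \<phi> u = v} \<le> cap v"
    using assms unfolding is_solution_def by auto
  have \<phi>V: "\<phi> u \<in> verts H" if "u \<in> verts H" for u using \<phi>(1)[OF that] S by blast
  show ?thesis
    unfolding solves_def
  proof (intro conjI allI impI ballI)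
    show "\<nu> ` S \<subseteq> V'" using S by blast
    show "card (\<nu> ` S) = nat k"
      using card_image[OF inj_on_subset[OF inj S(1)]] S(2) by simp
    show "a \<in> V'" "b \<in> \<nu> ` S" "(a, b) \<in> (E' \<union> Id) ^^ 6" if "(a, b) \<in> R' \<phi>" for a b
      using that \<phi> \<phi>V dist_iff by auto
    show "\<exists>b. (a, b) \<in> R' \<phi>" if "a \<in> V'" for a using that by blast
    show "b = c" if "(a, b) \<in> R' \<phi> \<and> (a, c) \<in> R' \<phi>" for a b c
      using that inj_onD[OF inj] by auto
    show "\<exists>c. (b, c) \<in> C' \<and> card {a. (a, b) \<in> R' \<phi>} \<le> c" if b: "b \<in> \<nu> ` S" for b
    proof -
      obtain v where v: "v \<in> S" "b = \<nu> v" using b by blast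
      then have "v \<in> verts H" using S by blast
      then have "card {a. (a, b) \<in> R' \<phi>} \<le> cap v"
        using card_fibre[of \<phi> v] \<phi>V load v by simp
      then show ?thesis using v \<open>v \<in> verts H\<close> by blast
    qed
  qed
qed

text \<open>The equations for \<open>T\<close> and \<open>R\<close> ensure that a number accepted by
  the test is literally the encoding of a solution.\<close>

lemma solves_imp_is_solution:
  assumes sol: "solves (nat k) V' E' C' T R" and "0 \<le> k"
  shows "\<exists>S \<phi>. is_solution 6 k cap H S \<phi> \<and> T = \<nu> ` S \<and> R = R' \<phi>"
proof -
  have T: "T \<subseteq> V'" "card T = nat k"
    and R: "\<And>a b. (a, b) \<in> R \<Longrightarrow> a \<in> V'" "\<And>a b. (a, b) \<in> R \<Longrightarrow> b \<in> T"
      "\<And>a b. (a, b) \<in> R \<Longrightarrow> (a, b) \<in> (E' \<union> Id) ^^ 6"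
    and total: "\<And>a. a \<in> V' \<Longrightarrow> \<exists>b. (a, b) \<in> R"
    and unique: "\<And>a b c. (a, b) \<in> R \<Longrightarrow> (a, c) \<in> R \<Longrightarrow> b = c"
    and load: "\<And>b. b \<in> T \<Longrightarrow> \<exists>c. (b, c) \<in> C' \<and> card {a. (a, b) \<in> R} \<le> c"
    using sol unfolding solves_def by blast+
  define S where "S = {v \<in> verts H. \<nu> v \<in> T}"
  have S: "S \<subseteq> verts H" "T = \<nu> ` S" using T(1) by (auto simp: S_def)
  have "\<exists>v. v \<in> verts H \<and> (\<nu> u, \<nu> v) \<in> R" if "u \<in> verts H" for u
    using total[of "\<nu> u"] R(2) T(1) that by blast
  then obtain \<phi> where \<phi>: "\<And>u. u \<in> verts H \<Longrightarrow> \<phi> u \<in> verts H" "\<And>u. u \<in> verts H \<Longrightarrow> (\<nu> u, \<nu> (\<phi> u)) \<in> R"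
    by metis
  have R_eq: "R = R' \<phi>"
  proof -
    have "(a, b) \<in> R' \<phi>" if "(a, b) \<in> R" for a b
      using R(1)[OF that] unique[OF that] \<phi>(2) by blast
    then show ?thesis using \<phi>(2) by auto
  qed
  have "is_solution 6 k cap H S \<phi>"
    unfolding is_solution_def
  proof (intro conjI ballI)
    show "int (card S) = k"
      using card_image[OF inj_on_subset[OF inj S(1)]] S(2) T(2) \<open>0 \<le> k\<close> by simp
    fix u assume u: "u \<in> verts H"
    show "\<phi> u \<in> S" using \<phi>[OF u] R(2) by (auto simp: S_def)
    show "graph_dist H u (\<phi> u) \<le> ereal (real 6)"
      using dist_iff[OF u \<phi>(1)[OF u]] R(3)[OF \<phi>(2)[OF u]] by blast
  next
    fix v assume v: "v \<in> S"
    then have "\<nu> v \<in> T" "v \<in> verts H" using S by auto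
    with load obtain c where c: "(\<nu> v, c) \<in> C'" "card {a. (a, \<nu> v) \<in> R} \<le> c" by blast
    then have "c = cap v" using inj_onD[OF inj] \<open>v \<in> verts H\<close> by auto
    then show "card {u \<in> verts H. \<phi> u = v} \<le> cap v"
      using c(2) card_fibre[OF \<phi>(1) \<open>v \<in> verts H\<close>] by (simp add: R_eq)
  qed (use S in auto)
  then show ?thesis using S R_eq by blast
qed

lemma encode_instance_eq:
  "encode_instance \<nu> k cap H =
     [nat k, set_encode V', set_encode (prod_encode ` E'), set_encode (prod_encode ` C')]"
  by (simp add: encode_instance_def image_image case_prod_unfold map_prod_def)

lemma encode_solution_eq:
  "encode_solution \<nu> H S \<phi> = prod_encode (set_encode (\<nu> ` S), set_encode (prod_encode ` R' \<phi>))"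
  by (simp add: encode_solution_def image_image)

lemma valid_code_iff:
  assumes "0 \<le> k"
  shows "valid z (nat k) (set_encode V') (set_encode (prod_encode ` E')) (set_encode (prod_encode ` C')) \<longleftrightarrow>
    (\<exists>S \<phi>. is_solution 6 k cap H S \<phi> \<and> z = encode_solution \<nu> H S \<phi>)"
proof -
  have "finite (arcs_ends H)"
    using finite_subset[OF arcs_ends_subset] fin by blast
  then have codes: "set_decode (set_encode V') = V'" "pairs (set_encode (prod_encode ` E')) = E'"
    "pairs (set_encode (prod_encode ` C')) = C'"
    using fin by (simp_all add: pairs_encode)
  show ?thesis
    unfolding valid_iff codes
  proof
    assume "\<exists>s f. z = prod_encode (s, f) \<and> solves (nat k) V' E' C' (set_decode s) (pairs f)"
    then obtain s f where z: "z = prod_encode (s, f)"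
      and sol: "solves (nat k) V' E' C' (set_decode s) (pairs f)" by blast
    from solves_imp_is_solution[OF sol assms] obtain S \<phi> where S: "is_solution 6 k cap H S \<phi>"
      "set_decode s = \<nu> ` S" "pairs f = R' \<phi>" by blast
    \<comment> \<open>A number is determined by the set that it decodes to.\<close>
    have "s = set_encode (\<nu> ` S)" "f = set_encode (prod_encode ` R' \<phi>)"
      using set_decode_inverse[of s] set_decode_inverse[of f] by (simp_all add: S set_decode_pairs[of f])
    then have "z = encode_solution \<nu> H S \<phi>"
      by (simp only: z encode_solution_eq)
    with S(1) show "\<exists>S \<phi>. is_solution 6 k cap H S \<phi> \<and> z = encode_solution \<nu> H S \<phi>"
      by blast
  next
    assume "\<exists>S \<phi>. is_solution 6 k cap H S \<phi> \<and> z = encode_solution \<nu> H S \<phi>"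
    then obtain S \<phi> where S: "is_solution 6 k cap H S \<phi>" "z = encode_solution \<nu> H S \<phi>" by blast
    have "finite S" using S(1) finite_subset[OF _ fin] by (simp add: is_solution_def)
    then have "set_decode (set_encode (\<nu> ` S)) = \<nu> ` S" "pairs (set_encode (prod_encode ` R' \<phi>)) = R' \<phi>"
      using fin by (simp_all add: pairs_encode)
    then show "\<exists>s f. z = prod_encode (s, f) \<and> solves (nat k) V' E' C' (set_decode s) (pairs f)"
      using is_solution_imp_solves[OF S(1)] S(2) encode_solution_eq by metis
  qed
qed

end

theorem theorem3:
  shows "\<exists>alg :: recf.
    \<forall>(V :: 'a set) (c :: 'a \<Rightarrow> 'a \<Rightarrow> real) (cap :: 'a \<Rightarrow> nat) (\<tau> :: real)
      (H :: ('a, 'a \<times> 'a) pre_digraph) (k :: int) (\<nu> :: 'a \<Rightarrow> nat).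
      zero_L_instance V c cap \<longrightarrow>
      0 \<le> \<tau> \<longrightarrow>
      is_component (with_proj (remove_zero_edges cap (threshold_graph V c \<tau>))) H \<longrightarrow>
      LP_feasible k cap H \<longrightarrow>
      inj_on \<nu> (verts H) \<longrightarrow>
      (\<exists>S \<phi>. is_solution 6 k cap H S \<phi> \<and>
             computes alg (encode_instance \<nu> k cap H) (encode_solution \<nu> H S \<phi>))"
proof -
  have pred: "rec_rel (Suc 4) (\<lambda>xs. valid (xs ! 0) (xs ! 1) (xs ! 2) (xs ! 3) (xs ! 4))"
    using rec_valid by simp
  \<comment> \<open>The program is fixed before any instance is given; the candidate code is the
    extra first argument of the test.\<close>
  obtain alg where alg: "\<And>xs. length xs = 4 \<Longrightarrow>
      \<exists>m. valid m (xs ! 0) (xs ! 1) (xs ! 2) (xs ! 3) \<Longrightarrow>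
      computes alg xs (LEAST m. valid m (xs ! 0) (xs ! 1) (xs ! 2) (xs ! 3))"
    using rec_mu[OF pred] by (simp, blast)
  show ?thesis
  proof (intro exI[of _ alg] allI impI)
    fix V :: "'a set" and c cap \<tau> and H :: "('a, 'a \<times> 'a) pre_digraph" and k :: int and \<nu> :: "'a \<Rightarrow> nat"
    assume inst: "zero_L_instance V c cap"
      and comp: "is_component (with_proj (remove_zero_edges cap (threshold_graph V c \<tau>))) H"
      and LP: "LP_feasible k cap H" and inj: "inj_on \<nu> (verts H)"
    note cg = component_cap_graph[OF inst comp]
    interpret labelled_graph H cap \<nu>
      using cg(1) cap_graph.finite_V[OF cg(4)] inj by (rule labelled_graph.intro)
    let ?P = "\<lambda>z. valid z (nat k) (set_encode V') (set_encode (prod_encode ` E')) (set_encode (prod_encode ` C'))"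
    obtain S0 \<phi>0 where S0: "is_solution 6 k cap H S0 \<phi>0"
      using rounding_exists[OF inst comp LP] by blast
    then have "0 \<le> k" by (auto simp: is_solution_def)
    have ex: "\<exists>z. ?P z"
      unfolding valid_code_iff[OF \<open>0 \<le> k\<close>] using S0 by blast
    then have "computes alg (encode_instance \<nu> k cap H) (LEAST z. ?P z)"
      using alg[of "encode_instance \<nu> k cap H"] unfolding encode_instance_eq by (simp add: numeral_2_eq_2 numeral_3_eq_3)
    \<comment> \<open>The least accepted number may encode a solution other than the one
      constructed, which served only to make the search halt.\<close>
    moreover obtain S \<phi> where "is_solution 6 k cap H S \<phi>" "(LEAST z. ?P z) = encode_solution \<nu> H S \<phi>"
      using LeastI_ex[OF ex] unfolding valid_code_iff[OF \<open>0 \<le> k\<close>] by blast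
    ultimately show "\<exists>S \<phi>. is_solution 6 k cap H S \<phi> \<and>
        computes alg (encode_instance \<nu> k cap H) (encode_solution \<nu> H S \<phi>)"
      by metis
  qed
qed

end
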